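(* Let $G$ be a finite simple graph on $[n]=\{1,\ldots,n\}$ with no isolated vertices whose complementary graph $G^c$ is chordal. Let $S=K[x_1,\ldots,x_n]$ be the polynomial ring over a field $K$, let $J(G)\subset S$ be the vertex cover ideal of $G$, and let $\Delta(G^c)$ be the clique complex of $G^c$ (which is a quasi-forest). Then the following conditions are equivalent: (i) $J(G)$ has a Scarf resolution; (ii) some leaf order of the facets of $\Delta(G^c)$ is sensitive; (iii) every leaf order of the facets of $\Delta(G^c)$ is sensitive.
   Context: Throughout, $\subset$ allows equality. The complementary graph $G^c$ of $G$ is the graph on $[n]$ whose edges are those $\{i,j\}$ with $i\ne j$ that are not edges of $G$. A graph is chordal if every cycle of length $>3$ has a chord. The clique complex $\Delta(H)$ of a graph $H$ on $[n]$ is the simplicial complex of all $W\subset[n]$ such that any two distinct elements of $W$ are adjacent in $H$. For $W\subset[n]$ put $x_W=\prod_{i\in W}x_i$. A vertex cover of $G$ is a set $W\subset[n]$ meeting every edge of $G$. The vertex cover ideal $J(G)$ is the ideal of $S$ generated by the monomials $x_W$ with $W$ a minimal (under inclusion) vertex cover of $G$. A facet $F$ of a simplicial complex $\Delta$ is a leaf of $\Delta$ if there is a facet $B\neq F$ of $\Delta$, called a branch of $F$ (in $\Delta$), such that $H\cap F\subset B\cap F$ for every facet $H\neq F$ of $\Delta$. For facets $F_1,\ldots,F_i$, let $\langle F_1,\ldots,F_i\rangle$ be the subcomplex of all faces contained in some $F_j$, $1\le j\le i$. A leaf order of $\Delta$ is a labelling $F_1,\ldots,F_q$ of all the facets of $\Delta$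 such that $F_i$ is a leaf of $\langle F_1,\ldots,F_i\rangle$ for all $1<i\le q$. A quasi-forest is a simplicial complex that has a leaf order. Given a leaf order $F_1,\ldots,F_q$ of $\Delta(G^c)$, for $1<i\le q$ let $G_i$ be a branch of $F_i$ in $\langle F_1,\ldots,F_i\rangle$. The leaf order is called sensitive if (a) for every $1<i\le q$, $G_i$ is the unique branch of $F_i$ in $\langle F_1,\ldots,F_i\rangle$; and (b) $G_i\cap F_i\not\subset G_j\cap F_j$ for all $i\ne j$ with $1<i,j\le q$. For a monomial ideal $J$ with minimal monomial generators $u_1,\ldots,u_q$, put $u_\sigma=\mathrm{lcm}(u_i: i\in\sigma)$ for $\sigma\subset\{1,\ldots,q\}$. The Scarf simplicial complex of $J$ consists of all $\sigma$ such that $u_\sigma\neq u_\tau$ for all $\tau\neq\sigma$. The (algebraic) Scarf complex of $J$ is the complex of free $S$-modules obtained by restricting the Taylor complex of $J$ to the faces of the Scarf simplicial complex. It is always a subcomplex of the minimal free resolution. We say that $J$ has a Scarf resolution if the Scarf complex is a (minimal) free resolution. *)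

theory Defs
  imports Complex_Main "HOL-Library.Poly_Mapping"
begin

section \<open>Graphs\<close>

text \<open>The vertex set \<open>[n]\<close> is the universe of a finite type \<open>'v\<close>, so \<open>n\<close> is the cardinality of
  \<open>'v\<close>; a graph is given by its set of edges, each edge being a set of two vertices.\<close>

definition simple_graph :: "'v::finite set set \<Rightarrow> bool" where
  "simple_graph G \<longleftrightarrow> (\<forall>e\<in>G. card e = 2)"

definition no_isolated_vertices :: "'v::finite set set \<Rightarrow> bool" where
  "no_isolated_vertices G \<longleftrightarrow> (\<forall>v. \<exists>e\<in>G. v \<in> e)"

definition complementary_graph :: "'v::finite set set \<Rightarrow> 'v set set" where
  "complementary_graph G = {{i, j} | i j. i \<noteq> j \<and> {i, j} \<notin> G}"

definition cycle_edges :: "'v list \<Rightarrow> 'v set set" where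
  "cycle_edges c = {{c ! i, c ! (Suc i mod length c)} | i. i < length c}"

definition is_cycle :: "'v set set \<Rightarrow> 'v list \<Rightarrow> bool" where
  "is_cycle H c \<longleftrightarrow> 3 \<le> length c \<and> distinct c \<and> cycle_edges c \<subseteq> H"

definition is_chord :: "'v set set \<Rightarrow> 'v list \<Rightarrow> 'v set \<Rightarrow> bool" where
  "is_chord H c e \<longleftrightarrow> e \<in> H \<and> e \<subseteq> set c \<and> e \<notin> cycle_edges c"

definition chordal :: "'v::finite set set \<Rightarrow> bool" where
  "chordal H \<longleftrightarrow> (\<forall>c. is_cycle H c \<and> length c > 3 \<longrightarrow> (\<exists>e. is_chord H c e))"

definition vertex_cover :: "'v::finite set set \<Rightarrow> 'v set \<Rightarrow> bool" where
  "vertex_cover G W \<longleftrightarrow> (\<forall>e\<in>G. W \<inter> e \<noteq> {})"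

definition minimal_vertex_cover :: "'v::finite set set \<Rightarrow> 'v set \<Rightarrow> bool" where
  "minimal_vertex_cover G W \<longleftrightarrow> vertex_cover G W \<and> (\<forall>W'. W' \<subset> W \<longrightarrow> \<not> vertex_cover G W')"

section \<open>Simplicial complexes and leaf orders\<close>

definition clique_complex :: "'v::finite set set \<Rightarrow> 'v set set" where
  "clique_complex H = {W. \<forall>i\<in>W. \<forall>j\<in>W. i \<noteq> j \<longrightarrow> {i, j} \<in> H}"

definition facets :: "'v set set \<Rightarrow> 'v set set" where
  "facets \<Delta> = {F \<in> \<Delta>. \<forall>H\<in>\<Delta>. F \<subseteq> H \<longrightarrow> H = F}"

definition generated_complex :: "'v set set \<Rightarrow> 'v set set" where
  "generated_complex \<F> = {W. \<exists>F\<in>\<F>. W \<subseteq> F}"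

definition is_branch :: "'v set set \<Rightarrow> 'v set \<Rightarrow> 'v set \<Rightarrow> bool" where
  "is_branch \<Delta> F B \<longleftrightarrow> B \<in> facets \<Delta> \<and> B \<noteq> F \<and>
     (\<forall>H\<in>facets \<Delta>. H \<noteq> F \<longrightarrow> H \<inter> F \<subseteq> B \<inter> F)"

definition is_leaf :: "'v set set \<Rightarrow> 'v set \<Rightarrow> bool" where
  "is_leaf \<Delta> F \<longleftrightarrow> F \<in> facets \<Delta> \<and> (\<exists>B. is_branch \<Delta> F B)"

text \<open>The list \<open>Fs\<close> is indexed from 0: its entry \<open>Fs ! i\<close> is the facet \<open>F\<^sub>i\<^sub>+\<^sub>1\<close>, and
  \<open>initial_complex Fs i\<close> is the subcomplex generated by \<open>F\<^sub>1, \<dots>, F\<^sub>i\<^sub>+\<^sub>1\<close>.\<close>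

definition initial_complex :: "'v set list \<Rightarrow> nat \<Rightarrow> 'v set set" where
  "initial_complex Fs i = generated_complex (set (take (Suc i) Fs))"

definition leaf_order :: "'v set set \<Rightarrow> 'v set list \<Rightarrow> bool" where
  "leaf_order \<Delta> Fs \<longleftrightarrow> distinct Fs \<and> set Fs = facets \<Delta> \<and>
     (\<forall>i. 0 < i \<and> i < length Fs \<longrightarrow> is_leaf (initial_complex Fs i) (Fs ! i))"

definition sensitive :: "'v set list \<Rightarrow> bool" where
  "sensitive Fs \<longleftrightarrow> (\<exists>B.
     (\<forall>i. 0 < i \<and> i < length Fs \<longrightarrow>
        is_branch (initial_complex Fs i) (Fs ! i) (B i) \<and>
        (\<forall>B'. is_branch (initial_complex Fs i) (Fs ! i) B' \<longrightarrow> B' = B i)) \<and>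
     (\<forall>i j. 0 < i \<and> i < length Fs \<and> 0 < j \<and> j < length Fs \<and> i \<noteq> j \<longrightarrow>
        \<not> B i \<inter> Fs ! i \<subseteq> B j \<inter> Fs ! j))"

section \<open>Monomials and ideals in the polynomial ring\<close>

text \<open>A monomial is represented by its exponent vector, and a polynomial by its finitely
  supported coefficient function on exponent vectors, so that multiplication of monomials is
  addition of exponent vectors.\<close>

type_synonym 'v monom = "'v \<Rightarrow>\<^sub>0 nat"
type_synonym ('v, 'k) mpoly = "('v \<Rightarrow>\<^sub>0 nat) \<Rightarrow>\<^sub>0 'k"

definition mono_poly :: "'v monom \<Rightarrow> ('v, 'k::field) mpoly" where
  "mono_poly m = Poly_Mapping.single m 1"

definition var :: "'v \<Rightarrow> ('v, 'k::field) mpoly" where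
  "var i = mono_poly (Poly_Mapping.single i 1)"

lemma module_times: "module ((*) :: 'a::comm_ring_1 \<Rightarrow> 'a \<Rightarrow> 'a)"
  by unfold_locales (simp_all add: algebra_simps)

definition ideal_gen :: "'a::comm_ring_1 set \<Rightarrow> 'a set" where
  "ideal_gen B = module.span (*) B"

definition vertex_cover_ideal :: "'v::finite set set \<Rightarrow> ('v, 'k::field) mpoly set" where
  "vertex_cover_ideal G = ideal_gen {\<Prod>i\<in>W. var i | W. minimal_vertex_cover G W}"

definition monom_dvd :: "'v monom \<Rightarrow> 'v monom \<Rightarrow> bool" where
  "monom_dvd m m' \<longleftrightarrow> (\<exists>k. m' = m + k)"

text \<open>The monomials in \<open>J\<close> that are minimal under divisibility; when \<open>J\<close> is a monomial ideal these
  are its minimal monomial generators.\<close>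

definition min_gens :: "('v, 'k::field) mpoly set \<Rightarrow> 'v monom set" where
  "min_gens J = {m. mono_poly m \<in> J \<and> (\<forall>m'. mono_poly m' \<in> J \<and> monom_dvd m' m \<longrightarrow> m' = m)}"

section \<open>Taylor and Scarf complexes\<close>

text \<open>Throughout, \<open>us\<close> lists the minimal monomial generators, and subsets of their index set
  are subsets of \<open>{..<length us}\<close>. The 0 makes the lcm of the empty family the monomial 1.\<close>

definition lcm_monom :: "'v::finite monom list \<Rightarrow> nat set \<Rightarrow> 'v monom" where
  "lcm_monom us \<sigma> =
     Abs_poly_mapping (\<lambda>v. Max (insert 0 ((\<lambda>i. Poly_Mapping.lookup (us ! i) v) ` \<sigma>)))"

definition scarf_faces :: "'v::finite monom list \<Rightarrow> nat set set" where
  "scarf_faces us = {\<sigma>. \<sigma> \<subseteq> {..<length us} \<and>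
     (\<forall>\<tau>. \<tau> \<subseteq> {..<length us} \<and> \<tau> \<noteq> \<sigma> \<longrightarrow> lcm_monom us \<sigma> \<noteq> lcm_monom us \<tau>)}"

text \<open>An element of the free module on basis elements \<open>e\<^sub>\<sigma>\<close> is its coordinate function
  \<open>\<sigma> \<mapsto> c \<sigma>\<close>. The Taylor differential is the linear map with
  \<open>e\<^sub>\<sigma> \<mapsto> \<Sum>j\<in>\<sigma>. (-1)^{number of i \<in> \<sigma> with i < j} \<cdot> (u\<^sub>\<sigma> / u\<^bsub>\<sigma> - {j}\<^esub>) \<cdot> e\<^bsub>\<sigma> - {j}\<^esub>\<close>. A face with \<open>k\<close> elements,
  that is, of dimension \<open>k - 1\<close>, contributes in homological degree \<open>k\<close>; so the complex ends in
  degree 0 with the empty face and is meant to resolve \<open>S/J\<close>.\<close>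

definition taylor_basis_diff ::
    "'v::finite monom list \<Rightarrow> nat set \<Rightarrow> nat set \<Rightarrow> ('v, 'k::field) mpoly" where
  "taylor_basis_diff us \<sigma> = (\<lambda>\<tau>. \<Sum>j\<in>\<sigma>. if \<tau> = \<sigma> - {j}
     then (- 1) ^ card {i\<in>\<sigma>. i < j} * mono_poly (lcm_monom us \<sigma> - lcm_monom us (\<sigma> - {j}))
     else 0)"

definition taylor_diff ::
    "'v::finite monom list \<Rightarrow> (nat set \<Rightarrow> ('v, 'k::field) mpoly) \<Rightarrow> nat set \<Rightarrow> ('v, 'k) mpoly" where
  "taylor_diff us c = (\<lambda>\<tau>. \<Sum>\<sigma>\<in>Pow {..<length us}. c \<sigma> * taylor_basis_diff us \<sigma> \<tau>)"

definition scarf_module ::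
    "'v::finite monom list \<Rightarrow> nat \<Rightarrow> (nat set \<Rightarrow> ('v, 'k::field) mpoly) set" where
  "scarf_module us k = {c. \<forall>\<sigma>. c \<sigma> \<noteq> 0 \<longrightarrow> \<sigma> \<in> scarf_faces us \<and> card \<sigma> = k}"

text \<open>The first three clauses say that the Scarf complex, augmented by the map from degree 0 to
  \<open>S/J\<close> sending the basis element of the empty face to the class of 1, is exact: in degrees
  \<open>k \<ge> 1\<close>, in degree 0, and at \<open>S/J\<close>. The last clause is minimality: the differential has
  entries in the maximal ideal generated by the variables.\<close>

definition scarf_complex_is_minimal_resolution ::
    "'v::finite monom list \<Rightarrow> ('v, 'k::field) mpoly set \<Rightarrow> bool" where
  "scarf_complex_is_minimal_resolution us J \<longleftrightarrow>
     (\<forall>k\<ge>1. {c :: nat set \<Rightarrow> ('v, 'k) mpoly. c \<in> scarf_module us k \<and> taylor_diff us c = (\<lambda>_. 0)}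
              = taylor_diff us ` scarf_module us (Suc k)) \<and>
     {c \<in> scarf_module us 0. c {} \<in> J} = taylor_diff us ` scarf_module us 1 \<and>
     (\<forall>s. \<exists>c \<in> scarf_module us 0. s - c {} \<in> J) \<and>
     (\<forall>k\<ge>1. \<forall>c :: nat set \<Rightarrow> ('v, 'k) mpoly. c \<in> scarf_module us k \<longrightarrow>
        (\<forall>\<tau>. taylor_diff us c \<tau> \<in> ideal_gen (range var)))"

text \<open>The labelling of the minimal generators affects the complex only up to isomorphism, so it
  does not matter which one is used.\<close>

definition has_scarf_resolution :: "('v::finite, 'k::field) mpoly set \<Rightarrow> bool" where
  "has_scarf_resolution J \<longleftrightarrow> (\<exists>us. distinct us \<and> set us = min_gens J \<and>
     scarf_complex_is_minimal_resolution us J)"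

end

theory Submission
  imports Defs
begin

text \<open>The minimal vertex covers of \<open>G\<close> are the complements of the facets \<open>F\<close> of \<open>\<Delta>(G\<^sup>c)\<close>, so the lcm of
  a set of generators is the squarefree monomial on the complement of the intersection of the
  corresponding facets, and a Scarf face is a set of facets determined by its intersection.
  A leaf order with chosen branches makes the facets the vertices of a rooted tree, each facet being
  joined to its branch. Since \<open>F\<^sub>k \<inter> F\<^sub>i\<close> lies in the branch of \<open>F\<^sub>i\<close> for all \<open>k < i\<close>, every Scarf face
  with at least two elements is an edge of this tree, and the order is sensitive exactly when all
  edges of the tree are Scarf faces. If they are, the Scarf complex is the complex of the tree, which
  is exact because a syzygy can be reduced against the edge at its last facet. If one edge is missing,
  the Scarf complex is disconnected and cannot be exact. A leaf order exists by Dirac's theorem on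
  simplicial vertices of chordal graphs.\<close>

section \<open>Simplicial vertices of chordal graphs\<close>

text \<open>Condition (i) mentions no order, so it serves as the hub: one sensitive order gives a
  Scarf resolution, and a Scarf resolution makes every leaf order sensitive. The existence of a leaf
  order is what turns (iii) into (ii). An edge of \<open>G\<close> keeps the full vertex set from
  being a face; hence no generator is 1, as the empty face and the single vertices require in order
  to be Scarf faces. The two clauses of sensitivity match the two ways in which a further facet can
  contain the intersection at a tree edge: an earlier facet would be a second branch, and a later
  facet would put this intersection inside the one at another edge. Non-exactness is detected by
  weighting the coefficient at each vertex with its generator and summing over one side of a cut:
  boundaries of edges that do not cross the cut have sum 0. In (i) the generators may be labelled in
  any order, so this argument uses a list of facets unrelated to the leaf order and describes the
  cut through facets instead of positions.\<close>

lemma shortest_walk: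
  assumes "(y, z) \<in> R\<^sup>*"
  obtains f :: "nat \<Rightarrow> 'a" and n where "f 0 = y" "f n = z" "\<And>i. i < n \<Longrightarrow> (f i, f (Suc i)) \<in> R"
    "inj_on f {..n}" "\<And>i j. Suc i < j \<Longrightarrow> j \<le> n \<Longrightarrow> (f i, f j) \<notin> R"
proof -
  define n where "n = (LEAST n. (y, z) \<in> R ^^ n)"
  have ex: "\<exists>n. (y, z) \<in> R ^^ n"
    using assms by (simp add: rtrancl_is_UN_relpow)
  have n: "(y, z) \<in> R ^^ n"
    unfolding n_def using LeastI_ex[OF ex] .
  have least: "n \<le> m" if "(y, z) \<in> R ^^ m" for m
    unfolding n_def using that by (rule Least_le)
  obtain f where f0: "f 0 = y" and fn: "f n = z" and step: "\<And>i. i < n \<Longrightarrow> (f i, f (Suc i)) \<in> R"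
    using n unfolding relpow_fun_conv by blast
  have start: "(y, f i) \<in> R ^^ i" if "i \<le> n" for i
    unfolding relpow_fun_conv using that f0 step by (intro exI[of _ f]) auto
  have rest: "(f j, z) \<in> R ^^ (n - j)" if "j \<le> n" for j
    unfolding relpow_fun_conv using that fn step by (intro exI[of _ "\<lambda>i. f (j + i)"]) auto
  \<comment> \<open>In a walk of least length nothing can be cut out. A repeated vertex would allow
    it here, and an \<open>R\<close>-step that skips vertices would allow it below.\<close>
  have neq: "f i \<noteq> f j" if "i < j" "j \<le> n" for i j
  proof
    assume "f i = f j"
    then have "(y, z) \<in> R ^^ (i + (n - j))"
      unfolding relpow_add using start[of i] rest[of j] that by auto
    then show False
      using least that by fastforce
  qed
  show ?thesis
  proof
    show "inj_on f {..n}"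
      using neq by (metis atMost_iff inj_onI linorder_neqE_nat)
    show "(f i, f j) \<notin> R" if "Suc i < j" "j \<le> n" for i j
    proof
      assume "(f i, f j) \<in> R"
      then have "(y, f j) \<in> R ^^ Suc i"
        using start[of i] that by auto
      then have "(y, z) \<in> R ^^ (Suc i + (n - j))"
        unfolding relpow_add using rest[of j] that by auto
      then show False
        using least that by fastforce
    qed
  qed (use f0 fn step in auto)
qed

definition edge_relation :: "'v set set \<Rightarrow> 'v set \<Rightarrow> ('v \<times> 'v) set" where
  "edge_relation H D = {(a, b). a \<in> D \<and> b \<in> D \<and> {a, b} \<in> H}"

lemma no_loop: "simple_graph H \<Longrightarrow> {a, b} \<in> H \<Longrightarrow> a \<noteq> b"
  by (auto simp: simple_graph_def)

text \<open>A shortest walk from \<open>y\<close> to \<open>z\<close> through \<open>D\<close> closes up at \<open>x\<close> to a cycle whose only possible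
  chord is \<open>{y, z}\<close>.\<close>

lemma chordal_detour:
  assumes H: "simple_graph H" and ch: "chordal H"
    and xy: "{x, y} \<in> H" and xz: "{x, z} \<in> H" and "y \<noteq> z"
    and D: "x \<notin> D" "\<And>d. d \<in> D \<Longrightarrow> {x, d} \<notin> H"
    and walk: "(y, z) \<in> (edge_relation H (D \<union> {y, z}))\<^sup>*"
  shows "{y, z} \<in> H"
proof (rule ccontr)
  assume nyz: "{y, z} \<notin> H"
  obtain f n where f0: "f 0 = y" and fn: "f n = z"
    and step: "\<And>i. i < n \<Longrightarrow> (f i, f (Suc i)) \<in> edge_relation H (D \<union> {y, z})"
    and inj: "inj_on f {..n}"
    and short: "\<And>i j. Suc i < j \<Longrightarrow> j \<le> n \<Longrightarrow> (f i, f j) \<notin> edge_relation H (D \<union> {y, z})"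
    using shortest_walk[OF walk] by blast
  have "n \<noteq> 0"
    using f0 fn \<open>y \<noteq> z\<close> by metis
  have "n \<noteq> 1"
    using f0 fn step[of 0] nyz by (auto simp: edge_relation_def)
  with \<open>n \<noteq> 0\<close> have n2: "2 \<le> n"
    by simp
  have xyz: "x \<noteq> y" "x \<noteq> z"
    using no_loop[OF H] xy xz by auto
  have fD: "f i \<in> D \<union> {y, z}" if "i \<le> n" for i
    using that step[of i] fn by (cases "i = n") (auto simp: edge_relation_def)
  then have fx: "f i \<noteq> x" if "i \<le> n" for i
    using that D(1) xyz by auto
  define c where "c = x # map f [0..<Suc n]"
  have len: "length c = n + 2"
    by (simp add: c_def)
  have c0: "c ! 0 = x"
    by (simp add: c_def)
  have cS: "c ! Suc i = f i" if "i \<le> n" for i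
    using that by (simp add: c_def del: upt_Suc)
  have setc: "set c = insert x (f ` {..n})"
    by (auto simp: c_def simp del: upt_Suc)
  have edge_last: "{z, x} \<in> cycle_edges c"
    unfolding cycle_edges_def using len c0 cS[of n] fn by (auto intro!: exI[of _ "Suc n"])
  have edge_first: "{x, y} \<in> cycle_edges c"
    unfolding cycle_edges_def using len c0 cS[of 0] f0 n2 by (auto intro!: exI[of _ 0])
  have edge_mid: "{f i, f (Suc i)} \<in> cycle_edges c" if "i < n" for i
    unfolding cycle_edges_def using len cS[of i] cS[of "Suc i"] that by (auto intro!: exI[of _ "Suc i"])
  have "cycle_edges c \<subseteq> H"
  proof
    fix e assume "e \<in> cycle_edges c"
    then obtain i where i: "i < n + 2" "e = {c ! i, c ! (Suc i mod (n + 2))}"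
      by (auto simp: cycle_edges_def len)
    \<comment> \<open>The edges of the cycle are \<open>{x, y}\<close>, the steps of the walk, and
      the closing edge \<open>{z, x}\<close>.\<close>
    consider "i = 0" | k where "i = Suc k" "k < n" | "i = Suc n"
      using i(1) by (cases i) (auto simp: less_Suc_eq)
    then show "e \<in> H"
    proof cases
      case 1
      then show ?thesis
        using i(2) c0 cS[of 0] f0 xy n2 by simp
    next
      case 2
      then show ?thesis
        using i(2) cS[of k] cS[of "Suc k"] step[of k] by (simp add: edge_relation_def)
    next
      case 3
      then show ?thesis
        using i(2) cS[of n] c0 fn xz by (simp add: insert_commute)
    qed
  qed
  moreover have "distinct c"
  proof -
    have "x \<notin> f ` {..n}"
      using fx by blast
    then show ?thesis
      using inj by (simp add: c_def distinct_map atLeast0LessThan lessThan_Suc_atMost del: upt_Suc)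
  qed
  ultimately have "is_cycle H c"
    using n2 by (simp add: is_cycle_def len)
  then obtain e where e: "e \<in> H" "e \<subseteq> set c" "e \<notin> cycle_edges c"
    using ch n2 len unfolding chordal_def is_chord_def by fastforce
  obtain a b where ab: "e = {a, b}" "a \<noteq> b"
    using H e(1) unfolding simple_graph_def by (meson card_2_iff)
  \<comment> \<open>A chord at \<open>x\<close> ends at a neighbour of \<open>x\<close> on the walk.
    There is none in \<open>D\<close>, so it ends at \<open>y\<close> or \<open>z\<close> and is an
    edge of the cycle.\<close>
  have not_x: False if "e = {x, w}" "x \<noteq> w" for w
  proof -
    have "w \<in> f ` {..n}"
      using that e(2) unfolding setc by blast
    then obtain i where "i \<le> n" "w = f i"
      by auto
    then have "w \<in> {y, z}"
      using fD[of i] D(2) that e(1) by auto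
    then show False
      using that e(3) edge_first edge_last by (auto simp: insert_commute)
  qed
  \<comment> \<open>A chord between two vertices of the walk would shorten the walk.\<close>
  have not_f: False if "e = {f i, f j}" "i < j" "j \<le> n" for i j
  proof (cases "j = Suc i")
    case True
    then show False
      using that e(3) edge_mid by simp
  next
    case False
    then have "(f i, f j) \<notin> edge_relation H (D \<union> {y, z})"
      using that by (intro short) auto
    then show False
      using that e(1) fD[of i] fD[of j] unfolding edge_relation_def by force
  qed
  have "a \<noteq> x" "b \<noteq> x"
    using not_x[of b] not_x[of a] ab by (auto simp: insert_commute)
  then obtain i j where "i \<le> n" "a = f i" "j \<le> n" "b = f j"
    using e(2) ab(1) setc by auto
  then show False
    using not_f[of i j] not_f[of j i] ab by (metis insert_commute linorder_neqE_nat)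
qed

lemma clique_complexD: "W \<in> clique_complex H \<Longrightarrow> i \<in> W \<Longrightarrow> j \<in> W \<Longrightarrow> i \<noteq> j \<Longrightarrow> {i, j} \<in> H"
  by (auto simp: clique_complex_def)

lemma clique_complex_subset: "W \<in> clique_complex H \<Longrightarrow> W' \<subseteq> W \<Longrightarrow> W' \<in> clique_complex H"
  by (auto simp: clique_complex_def)

text \<open>Prescribing a vertex \<open>x\<close> to be avoided is the strengthening that carries
  Dirac's induction. Let \<open>C\<close> be the component of \<open>y\<close> among the
  non-neighbours of \<open>x\<close>, and \<open>N\<close> the set of vertices outside
  \<open>C\<close> adjacent to \<open>C\<close>. All of \<open>N\<close> is adjacent to
  \<open>x\<close>, so detours through \<open>C\<close> make \<open>N\<close> a clique. If
  \<open>C \<union> N\<close> is a clique, \<open>y\<close> will do. Otherwise the induction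
  hypothesis for \<open>C \<union> N\<close>, which misses \<open>x\<close>, is arranged to give a
  vertex of \<open>C\<close>. Only the vertex set shrinks; \<open>H\<close> and its chordality stay
  fixed.\<close>

lemma chordal_simplicial_vertex_avoiding:
  assumes H: "simple_graph H" and ch: "chordal H"
    and "x \<in> V" "y \<in> V" "y \<noteq> x" "{x, y} \<notin> H"
  shows "\<exists>v\<in>V. v \<noteq> x \<and> {x, v} \<notin> H \<and> {w\<in>V. {v, w} \<in> H} \<in> clique_complex H"
  using assms(3-)
proof (induction "card V" arbitrary: V x y rule: less_induct)
  case less
  define U where "U = {w\<in>V. w \<noteq> x \<and> {x, w} \<notin> H}"
  define C where "C = {c. (y, c) \<in> (edge_relation H U)\<^sup>*}"
  define N where "N = {w\<in>V. w \<notin> C \<and> (\<exists>c\<in>C. {c, w} \<in> H)}"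
  have yC: "y \<in> C"
    by (simp add: C_def)
  have CU: "C \<subseteq> U"
  proof
    fix c assume "c \<in> C"
    then have "(y, c) \<in> (edge_relation H U)\<^sup>*"
      by (simp add: C_def)
    then show "c \<in> U"
      by (induction) (use less.prems in \<open>auto simp: U_def edge_relation_def\<close>)
  qed
  have Cclosed: "w \<in> C" if "c \<in> C" "w \<in> U" "{c, w} \<in> H" for c w
  proof -
    have "(c, w) \<in> edge_relation H U"
      using that CU by (auto simp: edge_relation_def)
    then show ?thesis
      using that(1) unfolding C_def by (auto intro: rtrancl_into_rtrancl)
  qed
  have xC: "x \<notin> C"
    using CU by (auto simp: U_def)
  have xN: "x \<notin> N"
    using CU by (auto simp: N_def U_def insert_commute)
  have Nx: "{x, w} \<in> H" if "w \<in> N" for w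
    using that Cclosed xN by (fastforce simp: N_def U_def)
  have conn: "(y, c) \<in> (edge_relation H C)\<^sup>*" if "c \<in> C" for c
  proof -
    have "(y, c) \<in> (edge_relation H U)\<^sup>*"
      using that by (simp add: C_def)
    then show ?thesis
    proof induction
      case (step b c)
      have "b \<in> C" "c \<in> C"
        using step.hyps unfolding C_def by (auto intro: rtrancl_into_rtrancl)
      then have "(b, c) \<in> edge_relation H C"
        using step.hyps by (auto simp: edge_relation_def)
      then show ?case
        using step.IH by (auto intro: rtrancl_into_rtrancl)
    qed simp
  qed
  have sym: "sym (edge_relation H D)" for D
    by (auto simp: sym_def edge_relation_def insert_commute)
  have Nclique: "{a, b} \<in> H" if "a \<in> N" "b \<in> N" "a \<noteq> b" for a b
  proof (rule chordal_detour[OF H ch Nx[OF that(1)] Nx[OF that(2)] that(3) xC])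
    show "{x, d} \<notin> H" if "d \<in> C" for d
      using that CU by (auto simp: U_def)
    let ?E = "edge_relation H (C \<union> {a, b})"
    obtain c d where cd: "c \<in> C" "{c, a} \<in> H" "d \<in> C" "{d, b} \<in> H"
      using \<open>a \<in> N\<close> \<open>b \<in> N\<close> by (auto simp: N_def)
    have mono: "(edge_relation H C)\<^sup>* \<subseteq> ?E\<^sup>*"
      by (intro rtrancl_mono) (auto simp: edge_relation_def)
    have "(a, c) \<in> ?E" "(d, b) \<in> ?E"
      using cd by (auto simp: edge_relation_def insert_commute)
    moreover have "(c, y) \<in> ?E\<^sup>*" "(y, d) \<in> ?E\<^sup>*"
      using mono conn[OF cd(1)] conn[OF cd(3)] symD[OF sym_rtrancl[OF sym]] by blast+
    ultimately show "(a, b) \<in> ?E\<^sup>*"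
      by (meson converse_rtrancl_into_rtrancl rtrancl_into_rtrancl rtrancl_trans)
  qed
  \<comment> \<open>A vertex of \<open>C\<close> has no neighbours in \<open>V\<close> beyond
    \<open>C \<union> N\<close>, so being simplicial there is the same as being simplicial in
    \<open>V\<close>.\<close>
  have nbhd: "{w\<in>V. {v, w} \<in> H} = {w \<in> C \<union> N. {v, w} \<in> H}" if "v \<in> C" for v
    using that CU by (auto simp: N_def U_def)
  have finish: ?case if "v \<in> C" "{w\<in>C \<union> N. {v, w} \<in> H} \<in> clique_complex H" for v
    using that nbhd[OF that(1)] CU by (intro bexI[of _ v]) (auto simp: U_def)
  have small: "card (C \<union> N) < card V"
  proof (rule psubset_card_mono)
    show "C \<union> N \<subset> V"
      using xC xN CU less.prems(1) by (auto simp: N_def U_def)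
  qed simp
  show ?case
  proof (cases "C \<union> N \<in> clique_complex H")
    case True
    show ?thesis
      by (rule finish[OF yC]) (rule clique_complex_subset[OF True], blast)
  next
    case False
    \<comment> \<open>The vertex to be avoided, \<open>p\<close>, is chosen so that the vertex
      \<open>v\<close> found by induction cannot lie in \<open>N\<close>: either \<open>p\<close> is
      in the clique \<open>N\<close>, or \<open>p\<close> is adjacent to all of \<open>N\<close>,
      while \<open>v\<close> is different from \<open>p\<close> and not adjacent to it.\<close>
    have "\<exists>p q. p \<in> C \<union> N \<and> q \<in> C \<union> N \<and> q \<noteq> p \<and> {p, q} \<notin> H \<and>
        (p \<in> N \<or> (\<forall>a\<in>N. {p, a} \<in> H))"
    proof (cases "\<exists>p\<in>N. \<exists>q\<in>C \<union> N. q \<noteq> p \<and> {p, q} \<notin> H")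
      case True
      then show ?thesis
        by blast
    next
      case nN: False
      have nN': "{a, b} \<in> H" if "a \<in> N" "b \<in> C \<union> N" "b \<noteq> a" for a b
        using nN that by meson
      obtain p q where pq: "p \<in> C \<union> N" "q \<in> C \<union> N" "p \<noteq> q" "{p, q} \<notin> H"
        using False unfolding clique_complex_def by blast
      then have "p \<notin> N"
        using nN'[of p q] by metis
      then have "\<forall>a\<in>N. {p, a} \<in> H"
        using nN'[of _ p] pq(1) by (metis insert_commute)
      then show ?thesis
        using pq by metis
    qed
    then obtain p q where pq: "p \<in> C \<union> N" "q \<in> C \<union> N" "q \<noteq> p" "{p, q} \<notin> H"
      and p: "p \<in> N \<or> (\<forall>a\<in>N. {p, a} \<in> H)"
      by blast
    obtain v where v: "v \<in> C \<union> N" "v \<noteq> p" "{p, v} \<notin> H" "{w\<in>C \<union> N. {v, w} \<in> H} \<in> clique_complex H"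
      using less.hyps[OF small pq] by (elim bexE conjE)
    have "v \<notin> N"
      using v(2,3) p Nclique[of p v] by auto
    then show ?thesis
      using finish v by blast
  qed
qed

lemma chordal_simplicial_vertex:
  assumes "simple_graph H" "chordal H" "V \<noteq> {}"
  obtains v where "v \<in> V" "{w\<in>V. {v, w} \<in> H} \<in> clique_complex H"
proof (cases "V \<in> clique_complex H")
  case True
  obtain v where "v \<in> V"
    using assms(3) by blast
  moreover have "{w\<in>V. {v, w} \<in> H} \<in> clique_complex H"
    by (rule clique_complex_subset[OF True]) blast
  ultimately show ?thesis
    using that by blast
next
  case False
  then obtain x y where "x \<in> V" "y \<in> V" "y \<noteq> x" "{x, y} \<notin> H"
    unfolding clique_complex_def by blast
  then show ?thesis
    using chordal_simplicial_vertex_avoiding[OF assms(1,2)] that by blast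
qed


section \<open>Leaf orders\<close>

definition antichain :: "'a set set \<Rightarrow> bool" where
  "antichain \<F> \<longleftrightarrow> (\<forall>A\<in>\<F>. \<forall>B\<in>\<F>. A \<subseteq> B \<longrightarrow> A = B)"

lemma antichainD: "antichain \<F> \<Longrightarrow> A \<in> \<F> \<Longrightarrow> B \<in> \<F> \<Longrightarrow> A \<subseteq> B \<Longrightarrow> A = B"
  by (auto simp: antichain_def)

lemma antichain_facets: "antichain (facets \<Delta>)"
  by (auto simp: antichain_def facets_def)

lemma facets_generated_complex: "antichain \<F> \<Longrightarrow> facets (generated_complex \<F>) = \<F>"
  by (fastforce simp: facets_def generated_complex_def antichain_def)

lemma facet_above:
  fixes W :: "'v::finite set"
  assumes "W \<in> \<Delta>"
  obtains F where "F \<in> facets \<Delta>" "W \<subseteq> F"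
proof -
  obtain F where "F \<in> \<Delta>" "W \<subseteq> F" "\<forall>U\<in>\<Delta>. F \<subseteq> U \<longrightarrow> F = U"
    using finite_has_maximal2[of \<Delta> W] assms by auto
  then show ?thesis
    using that[of F] by (auto simp: facets_def)
qed

text \<open>Since the facets form an antichain, the facets of the subcomplex generated by some of
  them are exactly those. A branch thus becomes a condition on list positions, the form used from
  here on.\<close>

lemma is_branch_initial_complex_iff:
  assumes "distinct Fs" "antichain (set Fs)" "i < length Fs"
  shows "is_branch (initial_complex Fs i) (Fs ! i) B \<longleftrightarrow>
    (\<exists>j<i. B = Fs ! j \<and> (\<forall>k<i. Fs ! k \<inter> Fs ! i \<subseteq> Fs ! j))"
proof -
  have "antichain (set (take (Suc i) Fs))"
    using assms(2) unfolding antichain_def by (meson in_set_takeD)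
  then have "facets (initial_complex Fs i) = set (take (Suc i) Fs)"
    by (simp add: initial_complex_def facets_generated_complex)
  also have "\<dots> = (!) Fs ` {..i}"
    using assms(3) by (simp add: nth_image[symmetric] atLeast0LessThan lessThan_Suc_atMost)
  finally have fac: "facets (initial_complex Fs i) = (!) Fs ` {..i}" .
  have ne: "Fs ! j \<noteq> Fs ! i" if "j < i" for j
    using assms(1,3) that by (simp add: nth_eq_iff_index_eq)
  have "(!) Fs ` {..i} - {Fs ! i} = (!) Fs ` {..<i}"
    using ne by (auto simp: le_less)
  then have others: "H \<in> (!) Fs ` {..i} \<and> H \<noteq> Fs ! i \<longleftrightarrow> H \<in> (!) Fs ` {..<i}" for H
    by (metis Diff_iff empty_iff insert_iff)
  have "is_branch (initial_complex Fs i) (Fs ! i) B \<longleftrightarrow>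
      B \<in> (!) Fs ` {..<i} \<and> (\<forall>H\<in>(!) Fs ` {..<i}. H \<inter> Fs ! i \<subseteq> B)"
  proof -
    have "is_branch (initial_complex Fs i) (Fs ! i) B \<longleftrightarrow> (B \<in> (!) Fs ` {..i} \<and> B \<noteq> Fs ! i) \<and>
        (\<forall>H. H \<in> (!) Fs ` {..i} \<and> H \<noteq> Fs ! i \<longrightarrow> H \<inter> Fs ! i \<subseteq> B)"
      unfolding is_branch_def fac by (metis inf.bounded_iff inf.cobounded2)
    then show ?thesis
      unfolding others by metis
  qed
  then show ?thesis
    by auto
qed

lemma leaf_order_iff:
  "leaf_order \<Delta> Fs \<longleftrightarrow> distinct Fs \<and> set Fs = facets \<Delta> \<and>
     (\<forall>i. 0 < i \<and> i < length Fs \<longrightarrow> (\<exists>j<i. \<forall>k<i. Fs ! k \<inter> Fs ! i \<subseteq> Fs ! j))"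
proof -
  have "is_leaf (initial_complex Fs i) (Fs ! i) \<longleftrightarrow> (\<exists>j<i. \<forall>k<i. Fs ! k \<inter> Fs ! i \<subseteq> Fs ! j)"
    if "distinct Fs" "set Fs = facets \<Delta>" "i < length Fs" for i
  proof -
    have anti: "antichain (set Fs)"
      using that(2) antichain_facets by metis
    have "antichain (set (take (Suc i) Fs))"
      using anti unfolding antichain_def by (meson in_set_takeD)
    then have "facets (initial_complex Fs i) = set (take (Suc i) Fs)"
      by (simp add: initial_complex_def facets_generated_complex)
    then have "Fs ! i \<in> facets (initial_complex Fs i)"
      using that(3) by (simp add: take_Suc_conv_app_nth)
    then show ?thesis
      unfolding is_leaf_def is_branch_initial_complex_iff[OF that(1) anti that(3)] by blast
  qed
  then show ?thesis
    unfolding leaf_order_def by blast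
qed

text \<open>Every clique through \<open>v\<close> lies in the clique \<open>insert v N\<close>, so
  this is the only new facet. An old facet is lost only if it lies in \<open>insert v N\<close>,
  hence in \<open>N\<close>, and then it equals \<open>N\<close>.\<close>

lemma facets_insert_simplicial:
  fixes V :: "'v::finite set"
  assumes H: "simple_graph H" and v: "v \<notin> V"
    and N: "N = {w\<in>V. {v, w} \<in> H}" "N \<in> clique_complex H"
  shows "facets {W\<in>clique_complex H. W \<subseteq> insert v V} =
    insert (insert v N) (facets {W\<in>clique_complex H. W \<subseteq> V} - {N})" (is "facets ?\<C>v = ?R")
proof -
  let ?\<C> = "{W\<in>clique_complex H. W \<subseteq> V}"
  have F: "insert v N \<in> ?\<C>v"
    using N unfolding clique_complex_def by (auto simp: insert_commute)
  have sub: "W \<subseteq> insert v N" if "W \<in> ?\<C>v" "v \<in> W" for W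
    using that N(1) by (auto dest: clique_complexD)
  have N': "N \<in> ?\<C>" "v \<notin> N"
    using N v by auto
  show ?thesis
  proof (intro equalityI subsetI)
    fix W assume W: "W \<in> facets ?\<C>v"
    show "W \<in> ?R"
    proof (cases "v \<in> W")
      case True
      then show ?thesis
        using W sub[of W] F unfolding facets_def by blast
    next
      case False
      then have "W \<in> ?\<C>" "\<forall>U\<in>?\<C>. W \<subseteq> U \<longrightarrow> U = W"
        using W unfolding facets_def by blast+
      moreover have "W \<noteq> N"
        using W F False unfolding facets_def by blast
      ultimately show ?thesis
        unfolding facets_def by blast
    qed
  next
    fix W assume "W \<in> ?R"
    then consider "W = insert v N" | "W \<in> facets ?\<C>" "W \<noteq> N"
      by blast
    then show "W \<in> facets ?\<C>v"
    proof cases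
      case 1
      then show ?thesis
        using F sub unfolding facets_def by blast
    next
      case 2
      have "U = W" if U: "U \<in> ?\<C>v" "W \<subseteq> U" for U
      proof (cases "v \<in> U")
        case True
        have "v \<notin> W"
          using 2 v unfolding facets_def by blast
        then have "W \<subseteq> N"
          using sub[OF U(1) True] U(2) by blast
        then have "W = N"
          using 2 N' unfolding facets_def by blast
        then show ?thesis
          using 2 by blast
      next
        case False
        then have "U \<in> ?\<C>"
          using U by blast
        then show ?thesis
          using 2 U unfolding facets_def by blast
      qed
      then show ?thesis
        using 2 unfolding facets_def by blast
    qed
  qed
qed

text \<open>Remove a simplicial vertex \<open>v\<close> with neighbourhood \<open>N\<close> and
  order the remaining facets. If \<open>N\<close> is among them, it is replaced in place by
  \<open>insert v N\<close>; no other facet contains \<open>v\<close>, so all pairwise intersections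
  and all branches survive. Otherwise \<open>insert v N\<close> is appended, and any facet above
  \<open>N\<close> is a branch of it.\<close>

lemma chordal_leaf_order_on:
  fixes H :: "'v::finite set set"
  assumes H: "simple_graph H" "chordal H"
  shows "\<exists>Fs. leaf_order {W\<in>clique_complex H. W \<subseteq> V} Fs"
proof (induction "card V" arbitrary: V)
  case 0
  then have "V = {}"
    by simp
  then have "facets {W\<in>clique_complex H. W \<subseteq> V} = {{}}"
    by (auto simp: facets_def clique_complex_def)
  then show ?case
    unfolding leaf_order_iff by (intro exI[of _ "[{}]"]) auto
next
  case (Suc n)
  then have "V \<noteq> {}"
    by auto
  then obtain v where "v \<in> V" and simp: "{w\<in>V. {v, w} \<in> H} \<in> clique_complex H"
    using chordal_simplicial_vertex[OF H] by blast
  define U where "U = V - {v}"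
  have V: "V = insert v U" "v \<notin> U"
    using \<open>v \<in> V\<close> by (auto simp: U_def)
  define N where "N = {w\<in>U. {v, w} \<in> H}"
  have "N = {w\<in>V. {v, w} \<in> H}"
    using no_loop[OF H(1)] by (auto simp: N_def V)
  then have N: "N \<in> clique_complex H"
    using simp by simp
  let ?\<C> = "{W\<in>clique_complex H. W \<subseteq> U}"
  have fac: "facets {W\<in>clique_complex H. W \<subseteq> V} = insert (insert v N) (facets ?\<C> - {N})"
    unfolding V(1) using H(1) V(2) N_def N by (rule facets_insert_simplicial)
  have "card U = n"
    using Suc.hyps(2) V by auto
  then obtain Fs where "leaf_order ?\<C> Fs"
    using Suc.hyps(1)[of U] by blast
  then have Fs: "distinct Fs" "set Fs = facets ?\<C>"
    and leaf: "\<And>i. 0 < i \<Longrightarrow> i < length Fs \<Longrightarrow> \<exists>j<i. \<forall>k<i. Fs ! k \<inter> Fs ! i \<subseteq> Fs ! j"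
    unfolding leaf_order_iff by auto
  have vF: "v \<notin> F" if "F \<in> set Fs" for F
    using that V(2) by (auto simp: Fs facets_def)
  show ?case
  proof (cases "N \<in> set Fs")
    case True
    then obtain m where m: "m < length Fs" "Fs ! m = N"
      by (auto simp: in_set_conv_nth)
    let ?Gs = "Fs[m := insert v N]"
    have inter: "?Gs ! k \<inter> ?Gs ! i = Fs ! k \<inter> Fs ! i" if "k < length Fs" "i < length Fs" "k \<noteq> i" for k i
      using that m vF[of "Fs ! i"] vF[of "Fs ! k"] by (auto simp: nth_list_update)
    have up: "Fs ! j \<subseteq> ?Gs ! j" for j
      using m by (cases "j = m") auto
    have "\<exists>j<i. \<forall>k<i. ?Gs ! k \<inter> ?Gs ! i \<subseteq> ?Gs ! j" if i: "0 < i" "i < length Fs" for i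
    proof -
      obtain j where j: "j < i" "\<forall>k<i. Fs ! k \<inter> Fs ! i \<subseteq> Fs ! j"
        using leaf[OF i] by blast
      have "?Gs ! k \<inter> ?Gs ! i \<subseteq> ?Gs ! j" if "k < i" for k
        using inter[of k i] up[of j] j(2) i that by auto
      then show ?thesis
        using j(1) by blast
    qed
    moreover have "distinct ?Gs"
      using Fs(1) vF by (intro distinct_list_update) auto
    moreover have "set ?Gs = insert (insert v N) (set Fs - {N})"
      using set_update_distinct[OF Fs(1) m(1)] m(2) by simp
    ultimately show ?thesis
      unfolding leaf_order_iff fac using Fs(2) by (intro exI[of _ ?Gs]) simp
  next
    case False
    obtain B where "B \<in> facets ?\<C>" "N \<subseteq> B"
      using facet_above[of N ?\<C>] N by (auto simp: N_def)
    then obtain b where b: "b < length Fs" "N \<subseteq> Fs ! b"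
      using Fs(2) by (metis in_set_conv_nth)
    let ?Gs = "Fs @ [insert v N]"
    have last: "Fs ! k \<inter> insert v N \<subseteq> Fs ! b" if "k < length Fs" for k
      using that b(2) vF[of "Fs ! k"] by auto
    have "\<exists>j<i. \<forall>k<i. ?Gs ! k \<inter> ?Gs ! i \<subseteq> ?Gs ! j" if i: "0 < i" "i < length ?Gs" for i
    proof (cases "i = length Fs")
      case True
      then show ?thesis
        using b(1) last by (intro exI[of _ b]) (simp add: nth_append)
    next
      case False
      with i have "i < length Fs"
        by simp
      with leaf[OF i(1) this] show ?thesis
        by (auto simp: nth_append)
    qed
    moreover have "distinct ?Gs"
      using Fs(1) vF by auto
    moreover have "set ?Gs = insert (insert v N) (facets ?\<C> - {N})"
      using Fs(2) False by auto
    ultimately show ?thesis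
      unfolding leaf_order_iff fac by (intro exI[of _ ?Gs]) simp
  qed
qed

lemma chordal_leaf_order_exists:
  "simple_graph H \<Longrightarrow> chordal H \<Longrightarrow> \<exists>Fs. leaf_order (clique_complex H) Fs"
  using chordal_leaf_order_on[of H UNIV] by simp

section \<open>Families of facets determined by their intersection\<close>

text \<open>The Scarf faces with facets in place of indices: passing to complements turns equal lcms
  into equal intersections, and \<open>\<Inter>{} = UNIV\<close> corresponds to the lcm 1 of the
  empty family.\<close>

definition scarf_family :: "'v set set \<Rightarrow> 'v set set \<Rightarrow> bool" where
  "scarf_family \<F> S \<longleftrightarrow> S \<subseteq> \<F> \<and> (\<forall>T\<subseteq>\<F>. \<Inter>T = \<Inter>S \<longrightarrow> T = S)"

lemma scarf_familyD: "scarf_family \<F> S \<Longrightarrow> T \<subseteq> \<F> \<Longrightarrow> \<Inter>T = \<Inter>S \<Longrightarrow> T = S"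
  by (auto simp: scarf_family_def)

lemma scarf_family_empty: "UNIV \<notin> \<F> \<Longrightarrow> scarf_family \<F> {}"
  unfolding scarf_family_def by auto

lemma scarf_family_singleton:
  assumes "antichain \<F>" "UNIV \<notin> \<F>" "F \<in> \<F>"
  shows "scarf_family \<F> {F}"
proof -
  have "T = {F}" if T: "T \<subseteq> \<F>" "\<Inter>T = F" for T
  proof -
    have "A = F" if "A \<in> T" for A
      using that T antichainD[OF assms(1,3), of A] by blast
    moreover have "T \<noteq> {}"
      using T(2) assms by auto
    ultimately show ?thesis
      by blast
  qed
  then show ?thesis
    using assms(3) by (simp add: scarf_family_def)
qed

text \<open>The list positions are the vertices of a rooted tree whose edges join each \<open>i > 0\<close> to \<open>parent i\<close>,
  the position of a branch of \<open>Fs ! i\<close>.\<close>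

locale branch_tree =
  fixes Fs :: "'v set list" and parent :: "nat \<Rightarrow> nat"
  assumes distinct: "distinct Fs"
    and anti: "antichain (set Fs)"
    and proper: "UNIV \<notin> set Fs"
    and parent_less: "0 < i \<Longrightarrow> i < length Fs \<Longrightarrow> parent i < i"
    and branch: "k < i \<Longrightarrow> i < length Fs \<Longrightarrow> Fs ! k \<inter> Fs ! i \<subseteq> Fs ! parent i"
begin

lemma parent_length: "0 < i \<Longrightarrow> i < length Fs \<Longrightarrow> parent i < length Fs"
  using parent_less[of i] by simp

lemma nth_eq: "i < length Fs \<Longrightarrow> j < length Fs \<Longrightarrow> Fs ! i = Fs ! j \<longleftrightarrow> i = j"
  by (simp add: distinct nth_eq_iff_index_eq)

text \<open>Let \<open>m\<close> be the last position in \<open>S\<close> and suppose that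
  \<open>S\<close> has another member. The branch of \<open>Fs ! m\<close> contains the intersection
  of \<open>S\<close>, so adjoining it leaves the intersection unchanged and it already belongs to
  \<open>S\<close>. A third member together with \<open>Fs ! m\<close> would force the intersection
  into the branch even after the branch is removed, so there is none.\<close>

lemma scarf_family_cases:
  assumes S: "scarf_family (set Fs) S"
  obtains "S = {}" | F where "F \<in> set Fs" "S = {F}"
  | i where "0 < i" "i < length Fs" "S = {Fs ! parent i, Fs ! i}"
proof -
  have SF: "S \<subseteq> set Fs"
    using S by (simp add: scarf_family_def)
  then have "S \<subseteq> (!) Fs ` {..<length Fs}"
    by (auto simp: set_conv_nth)
  then obtain \<sigma> where \<sigma>: "\<sigma> \<subseteq> {..<length Fs}" "S = (!) Fs ` \<sigma>"
    by (auto simp: subset_image_iff)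
  have fin: "finite \<sigma>"
    using \<sigma>(1) finite_subset by blast
  show ?thesis
  proof (cases "\<exists>k\<in>\<sigma>. k \<noteq> Max \<sigma>")
    case False
    then have "\<sigma> \<subseteq> {Max \<sigma>}"
      by auto
    then have "\<sigma> = {} \<or> \<sigma> = {Max \<sigma>}"
      by (simp add: subset_singleton_iff)
    then have "S = {} \<or> (\<exists>F\<in>set Fs. S = {F})"
      using \<sigma> by (metis image_empty image_insert insert_subset lessThan_iff nth_mem)
    then show ?thesis
      using that(1,2) by blast
  next
    case True
    define m where "m = Max \<sigma>"
    obtain k where k: "k \<in> \<sigma>" "k < m"
      using True Max_ge[OF fin] unfolding m_def by (metis le_neq_implies_less)
    have m: "m \<in> \<sigma>"
      unfolding m_def using k fin by (intro Max_in) auto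
    have mlen: "0 < m" "m < length Fs"
      using k m \<sigma>(1) by auto
    let ?P = "Fs ! parent m"
    have P: "?P \<in> set Fs"
      using parent_length[OF mlen] by simp
    have below: "\<Inter>T \<subseteq> ?P" if "T \<subseteq> S" "Fs ! m \<in> T" "Fs ! l \<in> T" "l < m" for T l
      using branch[of l m] that mlen by blast
    have "\<Inter>S \<subseteq> ?P"
      using k m \<sigma>(2) by (intro below[of S k]) auto
    then have "\<Inter>(insert ?P S) = \<Inter>S"
      by auto
    then have "insert ?P S = S"
      using P SF by (intro scarf_familyD[OF S]) auto
    then have PS: "?P \<in> S"
      by blast
    have "S \<subseteq> {?P, Fs ! m}"
    proof (rule ccontr)
      assume "\<not> S \<subseteq> {?P, Fs ! m}"
      then obtain l where l: "l \<in> \<sigma>" "Fs ! l \<noteq> ?P" "l \<noteq> m"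
        using \<sigma>(2) by auto
      then have "l < m"
        using Max_ge[OF fin] unfolding m_def by (metis le_neq_implies_less)
      have "?P \<noteq> Fs ! m"
        using nth_eq[OF parent_length[OF mlen] mlen(2)] parent_less[OF mlen] by simp
      then have "\<Inter>(S - {?P}) \<subseteq> ?P"
        using \<sigma>(2) m l \<open>l < m\<close> by (intro below[of _ l]) auto
      then have "\<Inter>(S - {?P}) = \<Inter>S"
        using PS by blast
      then show False
        using scarf_familyD[OF S, of "S - {?P}"] PS SF by blast
    qed
    then have "S = {?P, Fs ! m}"
      using PS m \<sigma>(2) by auto
    then show ?thesis
      using that(3) mlen by blast
  qed
qed

lemma branch_parent:
  assumes "0 < i" "i < length Fs"
  shows "is_branch (initial_complex Fs i) (Fs ! i) (Fs ! parent i)"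
  using is_branch_initial_complex_iff[OF distinct anti assms(2)] parent_less branch assms by blast

text \<open>A facet \<open>Fs ! k\<close> containing the intersection at the edge of
  \<open>i\<close> is excluded by clause (a) if \<open>k < i\<close>, unless it is the branch
  itself. If \<open>i < k\<close>, then \<open>Fs ! i \<inter> Fs ! k\<close> lies in the branch of
  \<open>Fs ! k\<close>, so the intersection at \<open>i\<close> would lie in the one at
  \<open>k\<close>, against clause (b). Proper subfamilies of the edge fail because distinct facets
  are incomparable.\<close>

lemma sensitive_imp_scarf_family:
  assumes "sensitive Fs" and i: "0 < i" "i < length Fs"
  shows "scarf_family (set Fs) {Fs ! parent i, Fs ! i}"
proof -
  obtain B where uniq: "\<And>i B'. 0 < i \<Longrightarrow> i < length Fs \<Longrightarrow> is_branch (initial_complex Fs i) (Fs ! i) B' \<Longrightarrow> B' = B i"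
    and incomp: "\<And>i j. 0 < i \<Longrightarrow> i < length Fs \<Longrightarrow> 0 < j \<Longrightarrow> j < length Fs \<Longrightarrow> i \<noteq> j \<Longrightarrow>
        \<not> B i \<inter> Fs ! i \<subseteq> B j \<inter> Fs ! j"
    using assms(1) unfolding sensitive_def by metis
  have B: "B i = Fs ! parent i" if "0 < i" "i < length Fs" for i
    using uniq[OF that branch_parent[OF that]] by simp
  let ?P = "Fs ! parent i"
  have mem: "?P \<in> set Fs" "Fs ! i \<in> set Fs"
    using parent_length i by auto
  have neq: "?P \<noteq> Fs ! i"
    using nth_eq[OF parent_length[OF i] i(2)] parent_less[OF i] by simp
  have "T = {?P, Fs ! i}" if T: "T \<subseteq> set Fs" "\<Inter>T = ?P \<inter> Fs ! i" for T
  proof -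
    have sub: "T \<subseteq> {?P, Fs ! i}"
    proof
      fix F assume "F \<in> T"
      then obtain k where k: "F = Fs ! k" "k < length Fs"
        using T(1) by (metis in_set_conv_nth subsetD)
      have le: "?P \<inter> Fs ! i \<subseteq> Fs ! k"
        using T(2) \<open>F \<in> T\<close> k(1) by blast
      show "F \<in> {?P, Fs ! i}"
      proof (rule linorder_cases[of k i])
        assume "k < i"
        have "Fs ! l \<inter> Fs ! i \<subseteq> Fs ! k" if "l < i" for l
          using branch[OF that i(2)] le by blast
        then have "is_branch (initial_complex Fs i) (Fs ! i) (Fs ! k)"
          using is_branch_initial_complex_iff[OF distinct anti i(2)] \<open>k < i\<close> by blast
        then show ?thesis
          using uniq[OF i] B[OF i] k(1) by simp
      next
        assume "i < k"
        then have "B i \<inter> Fs ! i \<subseteq> B k \<inter> Fs ! k"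
          using branch[of i k] k(2) i le B[of i] B[of k] by auto
        then show ?thesis
          using incomp[of i k] i k(2) \<open>i < k\<close> by auto
      qed (use k in simp)
    qed
    moreover have "T \<noteq> {}"
      using T(2) proper mem(1) by auto
    moreover have "T \<noteq> {F}" if "F \<in> {?P, Fs ! i}" for F
    proof
      assume "T = {F}"
      then have "F \<subseteq> ?P" "F \<subseteq> Fs ! i"
        using T(2) by auto
      then show False
        using that neq antichainD[OF anti mem] antichainD[OF anti mem(2) mem(1)] by auto
    qed
    ultimately show ?thesis
      by blast
  qed
  then show ?thesis
    using mem by (simp add: scarf_family_def)
qed

text \<open>Each violation produces a second family with the same intersection: another branch can
  replace the parent, and an inclusion between two edge intersections allows one edge to be adjoined
  to the other.\<close>

lemma scarf_family_imp_sensitive: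
  assumes scarf: "\<And>i. 0 < i \<Longrightarrow> i < length Fs \<Longrightarrow> scarf_family (set Fs) {Fs ! parent i, Fs ! i}"
  shows "sensitive Fs"
proof -
  have unique: "B' = Fs ! parent i"
    if i: "0 < i" "i < length Fs" and B': "is_branch (initial_complex Fs i) (Fs ! i) B'" for i B'
  proof -
    obtain j where j: "j < i" "B' = Fs ! j" "\<forall>k<i. Fs ! k \<inter> Fs ! i \<subseteq> Fs ! j"
      using B' unfolding is_branch_initial_complex_iff[OF distinct anti i(2)] by (elim exE conjE)
    have "Fs ! parent i \<inter> Fs ! i \<subseteq> Fs ! j" "Fs ! j \<inter> Fs ! i \<subseteq> Fs ! parent i"
      using j(3) parent_less[OF i] branch[OF j(1) i(2)] by simp_all
    then have "\<Inter>{Fs ! j, Fs ! i} = \<Inter>{Fs ! parent i, Fs ! i}"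
      by auto
    then have "{Fs ! j, Fs ! i} = {Fs ! parent i, Fs ! i}"
      using i j(1) by (intro scarf_familyD[OF scarf[OF i]]) auto
    then show ?thesis
      using j(2) by (metis doubleton_eq_iff)
  qed
  have incomparable: "\<not> Fs ! parent i \<inter> Fs ! i \<subseteq> Fs ! parent j \<inter> Fs ! j"
    if i: "0 < i" "i < length Fs" and j: "0 < j" "j < length Fs" and "i \<noteq> j" for i j
  proof
    assume "Fs ! parent i \<inter> Fs ! i \<subseteq> Fs ! parent j \<inter> Fs ! j"
    then have "\<Inter>{Fs ! parent i, Fs ! i, Fs ! parent j, Fs ! j} = \<Inter>{Fs ! parent i, Fs ! i}"
      by auto
    then have "{Fs ! parent i, Fs ! i, Fs ! parent j, Fs ! j} = {Fs ! parent i, Fs ! i}"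
      using i j parent_length by (intro scarf_familyD[OF scarf[OF i]]) auto
    then have "Fs ! j \<in> {Fs ! parent i, Fs ! i}" "Fs ! parent j \<in> {Fs ! parent i, Fs ! i}"
      by blast+
    \<comment> \<open>Both ends of the edge at \<open>j\<close> would be ends of the edge at
      \<open>i\<close>. An edge determines its larger end, so this contradicts
      \<open>i \<noteq> j\<close>.\<close>
    then have "j = parent i \<or> j = i" "parent j = parent i \<or> parent j = i"
      using nth_eq i j parent_length by auto
    then show False
      using \<open>i \<noteq> j\<close> parent_less[OF i] parent_less[OF j] by auto
  qed
  show ?thesis
    unfolding sensitive_def
    by (rule exI[of _ "\<lambda>i. Fs ! parent i"]) (use branch_parent unique incomparable in blast)
qed

text \<open>For \<open>0 < r < length Fs\<close> this is the component of \<open>r\<close> after the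
  edge between \<open>r\<close> and its parent is deleted: the side of the cut away from the
  root.\<close>

inductive_set descendants :: "nat \<Rightarrow> nat set" for r where
  self: "r \<in> descendants r"
| child: "parent i \<in> descendants r \<Longrightarrow> 0 < i \<Longrightarrow> i < length Fs \<Longrightarrow> i \<in> descendants r"

lemma descendants_ge: "i \<in> descendants r \<Longrightarrow> r \<le> i"
proof (induction rule: descendants.induct)
  case (child i)
  then show ?case
    using parent_less[of i] by simp
qed simp

lemma parent_notin_descendants: "0 < r \<Longrightarrow> r < length Fs \<Longrightarrow> parent r \<notin> descendants r"
  using descendants_ge[of "parent r" r] parent_less[of r] by auto

text \<open>No tree edge other than the one at \<open>r\<close> crosses the cut.\<close>

lemma descendants_parent_iff:
  "0 < i \<Longrightarrow> i < length Fs \<Longrightarrow> i \<noteq> r \<Longrightarrow> parent i \<in> descendants r \<longleftrightarrow> i \<in> descendants r"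
  using descendants.cases descendants.child by metis

end

lemma leaf_order_branch_tree:
  assumes "leaf_order \<Delta> Fs" "UNIV \<notin> facets \<Delta>"
  obtains parent where "branch_tree Fs parent"
proof -
  have Fs: "distinct Fs" "set Fs = facets \<Delta>"
    and ex: "\<forall>i. \<exists>j. 0 < i \<and> i < length Fs \<longrightarrow> j < i \<and> (\<forall>k<i. Fs ! k \<inter> Fs ! i \<subseteq> Fs ! j)"
    using assms(1) unfolding leaf_order_iff by auto
  obtain parent where "\<And>i. 0 < i \<Longrightarrow> i < length Fs \<Longrightarrow> parent i < i \<and> (\<forall>k<i. Fs ! k \<inter> Fs ! i \<subseteq> Fs ! parent i)"
    using choice[OF ex] by blast
  then have "branch_tree Fs parent"
    using Fs assms(2) antichain_facets[of \<Delta>] by unfold_locales auto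
  then show ?thesis
    by (rule that)
qed

section \<open>Monomials and the vertex cover ideal\<close>

lemma mono_poly_add: "mono_poly (a + b) = mono_poly a * mono_poly b"
  by (simp add: mono_poly_def mult_single)

lemma mono_poly_0: "mono_poly 0 = 1"
  by (simp add: mono_poly_def)

lemma mono_poly_ne_0: "mono_poly m \<noteq> 0"
  unfolding mono_poly_def by (metis lookup_single_eq lookup_zero zero_neq_one)

lemma keys_mono_poly: "Poly_Mapping.keys (mono_poly m :: ('v, 'k::field) mpoly) = {m}"
  by (simp add: mono_poly_def)

lemma lookup_mono_poly_mult: "Poly_Mapping.lookup (mono_poly m * p) (m + k) = Poly_Mapping.lookup p k"
proof -
  have "Poly_Mapping.lookup (mono_poly m * p) (m + k) =
      Sum_any (\<lambda>l. Sum_any (\<lambda>q. Poly_Mapping.lookup p q when m + k = l + q) when m = l)"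
    unfolding lookup_mult mono_poly_def by (intro Sum_any.cong) (simp add: lookup_single when_def)
  then show ?thesis
    by simp
qed

lemma mono_poly_mult_eq_0: "mono_poly m * p = 0 \<Longrightarrow> p = 0"
  by (rule poly_mapping_eqI) (metis lookup_mono_poly_mult lookup_zero)

lemma monom_dvd_iff: "monom_dvd m m' \<longleftrightarrow> (\<forall>v. Poly_Mapping.lookup m v \<le> Poly_Mapping.lookup m' v)"
proof
  assume *: "\<forall>v. Poly_Mapping.lookup m v \<le> Poly_Mapping.lookup m' v"
  have "m' = m + (m' - m)"
    by (rule poly_mapping_eqI) (use * in \<open>simp add: lookup_add lookup_minus\<close>)
  then show "monom_dvd m m'"
    unfolding monom_dvd_def by blast
qed (auto simp: monom_dvd_def lookup_add)

lemma monom_dvd_refl: "monom_dvd m m"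
  by (simp add: monom_dvd_iff)

lemma monom_dvd_trans: "monom_dvd a b \<Longrightarrow> monom_dvd b c \<Longrightarrow> monom_dvd a c"
  unfolding monom_dvd_iff by (meson order_trans)

lemma monom_dvd_antisym: "monom_dvd a b \<Longrightarrow> monom_dvd b a \<Longrightarrow> a = b"
  unfolding monom_dvd_iff by (intro poly_mapping_eqI) (simp add: antisym)

lemma monom_dvd_add_diff: "monom_dvd m m' \<Longrightarrow> m + (m' - m) = m'"
  by (auto simp: monom_dvd_def)

lemma mpoly_sum_single:
  fixes p :: "('v, 'k::field) mpoly"
  shows "p = (\<Sum>k\<in>Poly_Mapping.keys p. Poly_Mapping.single k (Poly_Mapping.lookup p k))"
proof (rule poly_mapping_eqI)
  fix t
  have "Poly_Mapping.lookup (\<Sum>k\<in>Poly_Mapping.keys p. Poly_Mapping.single k (Poly_Mapping.lookup p k)) t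
      = (\<Sum>k\<in>Poly_Mapping.keys p. if k = t then Poly_Mapping.lookup p k else 0)"
    by (simp add: lookup_sum lookup_single when_def)
  also have "\<dots> = Poly_Mapping.lookup p t"
    by (simp add: sum.delta in_keys_iff)
  finally show "Poly_Mapping.lookup p t = Poly_Mapping.lookup (\<Sum>k\<in>Poly_Mapping.keys p. Poly_Mapping.single k (Poly_Mapping.lookup p k)) t" ..
qed

lemma mono_poly_dvd:
  fixes p :: "('v, 'k::field) mpoly"
  assumes "\<And>k. k \<in> Poly_Mapping.keys p \<Longrightarrow> monom_dvd m k"
  obtains r where "p = mono_poly m * r"
proof -
  let ?c = "Poly_Mapping.lookup p"
  have "(\<Sum>k\<in>Poly_Mapping.keys p. Poly_Mapping.single k (?c k))
      = (\<Sum>k\<in>Poly_Mapping.keys p. mono_poly m * Poly_Mapping.single (k - m) (?c k))"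
  proof (rule sum.cong[OF refl])
    fix k assume "k \<in> Poly_Mapping.keys p"
    then have "m + (k - m) = k"
      by (intro monom_dvd_add_diff assms)
    then show "Poly_Mapping.single k (?c k) = mono_poly m * Poly_Mapping.single (k - m) (?c k)"
      by (simp add: mono_poly_def mult_single)
  qed
  also have "\<dots> = mono_poly m * (\<Sum>k\<in>Poly_Mapping.keys p. Poly_Mapping.single (k - m) (?c k))"
    by (rule sum_distrib_left[symmetric])
  finally have "p = mono_poly m * (\<Sum>k\<in>Poly_Mapping.keys p. Poly_Mapping.single (k - m) (?c k))"
    by (rule trans[OF mpoly_sum_single])
  then show ?thesis
    by (rule that)
qed

interpretation ideal: module "(*) :: 'a::comm_ring_1 \<Rightarrow> 'a \<Rightarrow> 'a"
  rewrites "module.span (*) = ideal_gen"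
proof -
  show "module ((*) :: 'a \<Rightarrow> 'a \<Rightarrow> 'a)"
    by (rule module_times)
  show "module.span (*) = (ideal_gen :: 'a set \<Rightarrow> 'a set)"
    by (rule ext) (rule ideal_gen_def[symmetric])
qed

lemma keys_ideal_gen:
  fixes p :: "('v, 'k::field) mpoly"
  assumes "p \<in> ideal_gen (mono_poly ` M)" "k \<in> Poly_Mapping.keys p"
  shows "\<exists>m\<in>M. monom_dvd m k"
  using assms
proof (induction arbitrary: k rule: ideal.span_induct_alt)
  case base
  then show ?case
    by simp
next
  case (step c x y)
  show ?case
  proof (cases "k \<in> Poly_Mapping.keys y")
    case True
    then show ?thesis
      by (rule step.IH)
  next
    case False
    obtain m where m: "m \<in> M" "x = mono_poly m"
      using step.hyps by blast
    have "k \<in> Poly_Mapping.keys (c * x)"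
      using step.prems False keys_add[of "c * x" y] by blast
    then obtain a where "k = a + m"
      using keys_mult[of c x] m(2) by (auto simp: keys_mono_poly)
    then have "monom_dvd m k"
      by (auto simp: monom_dvd_def add.commute)
    then show ?thesis
      using m(1) by blast
  qed
qed

lemma mono_poly_in_ideal_gen_iff:
  "(mono_poly k :: ('v, 'k::field) mpoly) \<in> ideal_gen (mono_poly ` M) \<longleftrightarrow> (\<exists>m\<in>M. monom_dvd m k)"
proof
  assume "\<exists>m\<in>M. monom_dvd m k"
  then obtain m where m: "m \<in> M" "monom_dvd m k"
    by blast
  have "(mono_poly k :: ('v, 'k) mpoly) = mono_poly (k - m) * mono_poly m"
    using monom_dvd_add_diff[OF m(2)] by (simp add: mono_poly_add[symmetric] add.commute)
  also have "\<dots> \<in> ideal_gen (mono_poly ` M)"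
    using m(1) by (intro ideal.span_scale ideal.span_base) simp
  finally show "(mono_poly k :: ('v, 'k) mpoly) \<in> ideal_gen (mono_poly ` M)" .
qed (use keys_ideal_gen[of "mono_poly k" M k] in \<open>simp add: keys_mono_poly\<close>)

lemma min_gens_ideal_gen:
  assumes "\<And>a b. a \<in> M \<Longrightarrow> b \<in> M \<Longrightarrow> monom_dvd a b \<Longrightarrow> a = b"
  shows "min_gens (ideal_gen (mono_poly ` M) :: ('v, 'k::field) mpoly set) = M"
  (is "min_gens ?J = M")
proof (intro equalityI subsetI)
  fix k assume "k \<in> min_gens ?J"
  then have k: "mono_poly k \<in> ?J" "\<And>m. mono_poly m \<in> ?J \<Longrightarrow> monom_dvd m k \<Longrightarrow> m = k"
    by (auto simp: min_gens_def)
  then obtain m where m: "m \<in> M" "monom_dvd m k"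
    by (auto simp: mono_poly_in_ideal_gen_iff)
  then have "mono_poly m \<in> ?J"
    using monom_dvd_refl by (auto simp: mono_poly_in_ideal_gen_iff)
  then show "k \<in> M"
    using k(2) m by metis
next
  fix k assume "k \<in> M"
  have "m = k" if m: "mono_poly m \<in> ?J" "monom_dvd m k" for m
  proof -
    obtain a where "a \<in> M" "monom_dvd a m"
      using m(1) unfolding mono_poly_in_ideal_gen_iff by blast
    then show ?thesis
      using assms[of a k] monom_dvd_trans[of a m k] monom_dvd_antisym[of m k] m(2) \<open>k \<in> M\<close> by blast
  qed
  then show "k \<in> min_gens ?J"
    using \<open>k \<in> M\<close> monom_dvd_refl by (auto simp: min_gens_def mono_poly_in_ideal_gen_iff)
qed

section \<open>Squarefree monomials and minimal vertex covers\<close>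

definition squarefree_monom :: "'v::finite set \<Rightarrow> 'v monom" where
  "squarefree_monom W = Abs_poly_mapping (\<lambda>v. if v \<in> W then 1 else 0)"

lemma lookup_squarefree_monom: "Poly_Mapping.lookup (squarefree_monom W) v = (if v \<in> W then 1 else 0)"
  by (simp add: squarefree_monom_def)

lemma squarefree_monom_eq_iff: "squarefree_monom W = squarefree_monom W' \<longleftrightarrow> W = W'"
proof
  assume "squarefree_monom W = squarefree_monom W'"
  then have "(if v \<in> W then 1 else 0 :: nat) = (if v \<in> W' then 1 else 0)" for v
    by (simp flip: lookup_squarefree_monom)
  then show "W = W'"
    by (metis set_eqI zero_neq_one)
qed simp

lemma squarefree_monom_dvd_iff: "monom_dvd (squarefree_monom W) (squarefree_monom W') \<longleftrightarrow> W \<subseteq> W'"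
proof -
  have "Poly_Mapping.lookup (squarefree_monom W) v \<le> Poly_Mapping.lookup (squarefree_monom W') v \<longleftrightarrow>
      (v \<in> W \<longrightarrow> v \<in> W')" for v
    by (simp add: lookup_squarefree_monom)
  then show ?thesis
    by (simp add: monom_dvd_iff subset_iff)
qed

lemma prod_var: "(\<Prod>i\<in>W. var i) = mono_poly (squarefree_monom W)"
  for W :: "'v::finite set"
proof (induction W rule: infinite_finite_induct)
  case empty
  have "squarefree_monom ({} :: 'v set) = 0"
    by (rule poly_mapping_eqI) (simp add: lookup_squarefree_monom)
  then show ?case
    by (simp add: mono_poly_0)
next
  case (insert i W)
  have "squarefree_monom (insert i W) = Poly_Mapping.single i 1 + squarefree_monom W"
    by (rule poly_mapping_eqI)
      (use insert.hyps in \<open>auto simp: lookup_squarefree_monom lookup_add lookup_single when_def\<close>)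
  then show ?case
    using insert by (simp add: mono_poly_add var_def)
qed simp

text \<open>The generator belonging to a facet \<open>F\<close>. Complementation reverses inclusion,
  so divisibility of these monomials is reverse inclusion of the faces.\<close>

abbreviation cover_monom :: "'v::finite set \<Rightarrow> 'v monom" where
  "cover_monom F \<equiv> squarefree_monom (- F)"

lemma complementary_graph_iff: "{i, j} \<in> complementary_graph G \<longleftrightarrow> i \<noteq> j \<and> {i, j} \<notin> G"
proof
  assume "{i, j} \<in> complementary_graph G"
  then obtain a b where "{i, j} = {a, b}" "a \<noteq> b" "{a, b} \<notin> G"
    unfolding complementary_graph_def by blast
  then show "i \<noteq> j \<and> {i, j} \<notin> G"
    by force
qed (auto simp: complementary_graph_def)

text \<open>A set meets every edge exactly when its complement contains no edge, that is, when the
  complement is a clique of the complementary graph.\<close>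

lemma vertex_cover_iff:
  assumes "simple_graph G"
  shows "vertex_cover G W \<longleftrightarrow> - W \<in> clique_complex (complementary_graph G)"
proof -
  have "- W \<in> clique_complex (complementary_graph G) \<longleftrightarrow> (\<forall>i\<in>- W. \<forall>j\<in>- W. i \<noteq> j \<longrightarrow> {i, j} \<notin> G)"
    unfolding clique_complex_def by (auto simp: complementary_graph_iff)
  also have "\<dots> \<longleftrightarrow> vertex_cover G W"
    unfolding vertex_cover_def
  proof (intro iffI ballI impI)
    fix e assume *: "\<forall>i\<in>- W. \<forall>j\<in>- W. i \<noteq> j \<longrightarrow> {i, j} \<notin> G" and "e \<in> G"
    then obtain i j where "e = {i, j}" "i \<noteq> j"
      using assms unfolding simple_graph_def by (meson card_2_iff)
    then show "W \<inter> e \<noteq> {}"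
      using * \<open>e \<in> G\<close> by blast
  next
    fix i j assume *: "\<forall>e\<in>G. W \<inter> e \<noteq> {}" "i \<in> - W" "j \<in> - W"
    then have "W \<inter> {i, j} = {}"
      by simp
    then show "{i, j} \<notin> G"
      using *(1) by metis
  qed
  finally show ?thesis ..
qed

lemma minimal_vertex_cover_iff:
  assumes "simple_graph G"
  shows "minimal_vertex_cover G W \<longleftrightarrow> - W \<in> facets (clique_complex (complementary_graph G))"
proof -
  let ?\<C> = "clique_complex (complementary_graph G)"
  have "(\<forall>W'. W' \<subset> W \<longrightarrow> - W' \<notin> ?\<C>) \<longleftrightarrow> (\<forall>H\<in>?\<C>. - W \<subseteq> H \<longrightarrow> H = - W)"
  proof (intro iffI ballI allI impI notI)
    fix H assume *: "\<forall>W'. W' \<subset> W \<longrightarrow> - W' \<notin> ?\<C>" "H \<in> ?\<C>" "- W \<subseteq> H"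
    have "\<not> - H \<subset> W"
      using *(1)[rule_format, of "- H"] *(2) by auto
    then show "H = - W"
      using *(3) by blast
  next
    fix W' assume *: "\<forall>H\<in>?\<C>. - W \<subseteq> H \<longrightarrow> H = - W" "W' \<subset> W" "- W' \<in> ?\<C>"
    have "- W' = - W"
      using *(1)[rule_format, of "- W'"] *(2,3) by auto
    then show False
      using *(2) by auto
  qed
  then show ?thesis
    unfolding minimal_vertex_cover_def vertex_cover_iff[OF assms] facets_def by simp
qed

lemma vertex_cover_ideal_eq:
  assumes "simple_graph G"
  shows "(vertex_cover_ideal G :: ('v::finite, 'k::field) mpoly set) =
    ideal_gen (mono_poly ` cover_monom ` facets (clique_complex (complementary_graph G)))"
proof -
  let ?\<F> = "facets (clique_complex (complementary_graph G))"
  have "p \<in> {\<Prod>i\<in>W. var i | W. minimal_vertex_cover G W} \<longleftrightarrow> p \<in> mono_poly ` cover_monom ` ?\<F>" for p :: "('v, 'k) mpoly"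
  proof
    assume "p \<in> {\<Prod>i\<in>W. var i | W. minimal_vertex_cover G W}"
    then obtain W where W: "p = (\<Prod>i\<in>W. var i)" "minimal_vertex_cover G W"
      by blast
    have "p = mono_poly (cover_monom (- W))"
      using W(1) by (simp add: prod_var)
    moreover have "- W \<in> ?\<F>"
      using W(2) minimal_vertex_cover_iff[OF assms] by simp
    ultimately show "p \<in> mono_poly ` cover_monom ` ?\<F>"
      by (metis imageI)
  next
    assume "p \<in> mono_poly ` cover_monom ` ?\<F>"
    then obtain F where F: "F \<in> ?\<F>" "p = mono_poly (cover_monom F)"
      by blast
    have "minimal_vertex_cover G (- F)"
      using F(1) minimal_vertex_cover_iff[OF assms, of "- F"] by simp
    moreover have "p = (\<Prod>i\<in>- F. var i)"
      using F(2) by (simp add: prod_var)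
    ultimately show "p \<in> {\<Prod>i\<in>W. var i | W. minimal_vertex_cover G W}"
      by blast
  qed
  then have "{\<Prod>i\<in>W. var i | W. minimal_vertex_cover G W} = (mono_poly ` cover_monom ` ?\<F> :: ('v, 'k) mpoly set)"
    by (rule set_eqI)
  then show ?thesis
    by (simp only: vertex_cover_ideal_def)
qed

lemma min_gens_cover_monom:
  assumes "antichain \<F>"
  shows "min_gens (ideal_gen (mono_poly ` cover_monom ` \<F>) :: ('v::finite, 'k::field) mpoly set)
    = cover_monom ` \<F>"
proof (rule min_gens_ideal_gen)
  fix a b assume "a \<in> cover_monom ` \<F>" "b \<in> cover_monom ` \<F>" "monom_dvd a b"
  then obtain A B where "A \<in> \<F>" "B \<in> \<F>" "B \<subseteq> A" "a = cover_monom A" "b = cover_monom B"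
    by (auto simp: squarefree_monom_dvd_iff)
  then show "a = b"
    using antichainD[OF assms, of B A] by simp
qed

section \<open>Taylor and Scarf complexes\<close>

lemma lookup_lcm_monom:
  "Poly_Mapping.lookup (lcm_monom us \<sigma>) v = Max (insert 0 ((\<lambda>i. Poly_Mapping.lookup (us ! i) v) ` \<sigma>))"
  by (simp add: lcm_monom_def)

lemma lcm_monom_empty: "lcm_monom us {} = 0"
  by (rule poly_mapping_eqI) (simp add: lookup_lcm_monom)

lemma lcm_monom_singleton: "lcm_monom us {k} = us ! k"
  by (rule poly_mapping_eqI) (simp add: lookup_lcm_monom)

lemma lcm_monom_mono:
  assumes "finite \<sigma>" "\<tau> \<subseteq> \<sigma>"
  shows "monom_dvd (lcm_monom us \<tau>) (lcm_monom us \<sigma>)"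
  unfolding monom_dvd_iff lookup_lcm_monom using assms by (intro allI Max_mono) auto

text \<open>The lcm of squarefree monomials has the union of their supports as support, and De
  Morgan turns the union of complements into the complement of the intersection. For empty
  \<open>\<sigma>\<close> both sides are the monomial 1.\<close>

lemma lcm_cover_monom:
  assumes "\<sigma> \<subseteq> {..<length Gs}"
  shows "lcm_monom (map cover_monom Gs) \<sigma> = cover_monom (\<Inter>((!) Gs ` \<sigma>))"
proof (rule poly_mapping_eqI)
  fix v
  have fin: "finite \<sigma>"
    using assms finite_subset by blast
  have nth: "Poly_Mapping.lookup (map cover_monom Gs ! i) v = (if v \<in> Gs ! i then 0 else 1)" if "i \<in> \<sigma>" for i
    using that assms by (auto simp: lookup_squarefree_monom)
  have img: "(\<lambda>i. Poly_Mapping.lookup (map cover_monom Gs ! i) v) ` \<sigma> = (\<lambda>i. if v \<in> Gs ! i then 0 else 1) ` \<sigma>"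
    by (rule image_cong[OF refl nth])
  have "Max (insert 0 ((\<lambda>i. if v \<in> Gs ! i then 0 else 1) ` \<sigma>)) = (if \<forall>i\<in>\<sigma>. v \<in> Gs ! i then 0 else 1 :: nat)"
    using fin by (intro Max_eqI) (auto simp: image_iff)
  then show "Poly_Mapping.lookup (lcm_monom (map cover_monom Gs) \<sigma>) v =
      Poly_Mapping.lookup (cover_monom (\<Inter>((!) Gs ` \<sigma>))) v"
    unfolding lookup_lcm_monom img lookup_squarefree_monom by simp
qed

lemma scarf_faces_cover_monom:
  assumes "distinct Gs"
  shows "\<sigma> \<in> scarf_faces (map cover_monom Gs) \<longleftrightarrow>
    \<sigma> \<subseteq> {..<length Gs} \<and> scarf_family (set Gs) ((!) Gs ` \<sigma>)"
proof (cases "\<sigma> \<subseteq> {..<length Gs}")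
  case True
  have inj: "inj_on ((!) Gs) {..<length Gs}"
    using assms by (simp add: inj_on_nth)
  have set: "set Gs = (!) Gs ` {..<length Gs}"
    by (auto simp: set_conv_nth)
  have eq: "lcm_monom (map cover_monom Gs) \<sigma> = lcm_monom (map cover_monom Gs) \<tau> \<longleftrightarrow>
      \<Inter>((!) Gs ` \<tau>) = \<Inter>((!) Gs ` \<sigma>)" if "\<tau> \<subseteq> {..<length Gs}" for \<tau>
    unfolding lcm_cover_monom[OF that] lcm_cover_monom[OF True] squarefree_monom_eq_iff by auto
  have "\<sigma> \<in> scarf_faces (map cover_monom Gs) \<longleftrightarrow>
      (\<forall>\<tau>\<subseteq>{..<length Gs}. \<Inter>((!) Gs ` \<tau>) = \<Inter>((!) Gs ` \<sigma>) \<longrightarrow> \<tau> = \<sigma>)"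
  proof -
    have "\<sigma> \<in> scarf_faces (map cover_monom Gs) \<longleftrightarrow>
        (\<forall>\<tau>\<subseteq>{..<length Gs}. lcm_monom (map cover_monom Gs) \<sigma> = lcm_monom (map cover_monom Gs) \<tau> \<longrightarrow> \<tau> = \<sigma>)"
      unfolding scarf_faces_def using True by (simp, metis)
    then show ?thesis
      by (simp add: eq)
  qed
  also have "\<dots> \<longleftrightarrow> (\<forall>\<tau>\<subseteq>{..<length Gs}. \<Inter>((!) Gs ` \<tau>) = \<Inter>((!) Gs ` \<sigma>) \<longrightarrow> (!) Gs ` \<tau> = (!) Gs ` \<sigma>)"
    using inj_on_image_eq_iff[OF inj _ True] by simp
  also have "\<dots> \<longleftrightarrow> scarf_family (set Gs) ((!) Gs ` \<sigma>)"
    unfolding scarf_family_def set all_subset_image using image_mono[OF True, of "(!) Gs"] by simp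
  finally show ?thesis
    using True by simp
qed (simp add: scarf_faces_def)

lemma scarf_faces_finite: "\<sigma> \<in> scarf_faces us \<Longrightarrow> finite \<sigma>"
  unfolding scarf_faces_def using finite_subset by blast

lemma scarf_faces_subset: "\<sigma> \<in> scarf_faces us \<Longrightarrow> \<sigma> \<subseteq> {..<length us}"
  by (simp add: scarf_faces_def)

section \<open>The Taylor differential on vertices and edges\<close>

lemma taylor_basis_diff_ne_0:
  "taylor_basis_diff us \<sigma> \<tau> \<noteq> 0 \<Longrightarrow> \<exists>j\<in>\<sigma>. \<tau> = \<sigma> - {j}"
  unfolding taylor_basis_diff_def by (erule contrapos_np) (auto intro!: sum.neutral)

lemma taylor_basis_diff_singleton:
  "taylor_basis_diff us {k} \<tau> = (if \<tau> = {} then mono_poly (us ! k) else 0)"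
proof -
  have none: "{i. i = k \<and> i < k} = {}"
    by auto
  show ?thesis
    by (simp add: none taylor_basis_diff_def lcm_monom_singleton lcm_monom_empty)
qed

lemma taylor_basis_diff_pair:
  assumes "a < b"
  shows "taylor_basis_diff us {a, b} \<tau> =
    (if \<tau> = {b} then mono_poly (lcm_monom us {a, b} - us ! b)
     else if \<tau> = {a} then - mono_poly (lcm_monom us {a, b} - us ! a) else 0)"
proof -
  have minus: "{a, b} - {a} = {b}" "{a, b} - {b} = {a}"
    using assms by auto
  have below: "{i. (i = a \<or> i = b) \<and> i < a} = {}" "{i. (i = a \<or> i = b) \<and> i < b} = {a}"
    using assms by auto
  show ?thesis
    using assms by (simp add: below minus taylor_basis_diff_def lcm_monom_singleton)
qed

lemma taylor_diff_add:
  "taylor_diff us (\<lambda>\<sigma>. f \<sigma> + g \<sigma>) = (\<lambda>\<tau>. taylor_diff us f \<tau> + taylor_diff us g \<tau>)"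
  by (simp add: taylor_diff_def distrib_right sum.distrib)

lemma taylor_diff_single:
  assumes "\<sigma> \<subseteq> {..<length us}"
  shows "taylor_diff us (\<lambda>\<rho>. if \<rho> = \<sigma> then r else 0) = (\<lambda>\<tau>. r * taylor_basis_diff us \<sigma> \<tau>)"
proof
  fix \<tau>
  have "taylor_diff us (\<lambda>\<rho>. if \<rho> = \<sigma> then r else 0) \<tau>
      = (\<Sum>\<rho>\<in>Pow {..<length us}. if \<rho> = \<sigma> then r * taylor_basis_diff us \<sigma> \<tau> else 0)"
    unfolding taylor_diff_def by (intro sum.cong) auto
  then show "taylor_diff us (\<lambda>\<rho>. if \<rho> = \<sigma> then r else 0) \<tau> = r * taylor_basis_diff us \<sigma> \<tau>"
    using assms by (simp add: sum.delta)
qed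

lemma taylor_diff_zero: "taylor_diff us (\<lambda>_. 0) = (\<lambda>_. 0)"
  by (simp add: taylor_diff_def)

lemma scarf_module_zero: "(\<lambda>_. 0) \<in> scarf_module us k"
  by (simp add: scarf_module_def)

lemma taylor_diff_ne_0:
  assumes "c \<in> scarf_module us k" "taylor_diff us c \<tau> \<noteq> 0"
  shows "\<exists>\<sigma>\<in>scarf_faces us. card \<sigma> = k \<and> (\<exists>j\<in>\<sigma>. \<tau> = \<sigma> - {j})"
proof -
  obtain \<sigma> where "c \<sigma> * taylor_basis_diff us \<sigma> \<tau> \<noteq> 0"
    using assms(2) unfolding taylor_diff_def by (meson sum.neutral)
  from mult_not_zero[OF this] have "c \<sigma> \<noteq> 0" "\<exists>j\<in>\<sigma>. \<tau> = \<sigma> - {j}"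
    using taylor_basis_diff_ne_0 by blast+
  then show ?thesis
    using assms(1) by (auto simp: scarf_module_def)
qed

lemma taylor_diff_card:
  assumes "c \<in> scarf_module us k" "taylor_diff us c \<tau> \<noteq> 0"
  shows "\<tau> \<subseteq> {..<length us}" "Suc (card \<tau>) = k"
proof -
  obtain \<sigma> j where \<sigma>: "\<sigma> \<in> scarf_faces us" "card \<sigma> = k" "j \<in> \<sigma>" "\<tau> = \<sigma> - {j}"
    using taylor_diff_ne_0[OF assms] by blast
  show "\<tau> \<subseteq> {..<length us}"
    using \<sigma>(4) scarf_faces_subset[OF \<sigma>(1)] by auto
  show "Suc (card \<tau>) = k"
    using card.remove[OF scarf_faces_finite[OF \<sigma>(1)] \<sigma>(3)] \<sigma>(2,4) by simp
qed

lemma taylor_diff_empty: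
  "taylor_diff us c {} = (\<Sum>k<length us. c {k} * mono_poly (us ! k))"
proof -
  have "taylor_diff us c {} = (\<Sum>\<sigma>\<in>(\<lambda>k. {k}) ` {..<length us}. c \<sigma> * taylor_basis_diff us \<sigma> {})"
    unfolding taylor_diff_def
  proof (rule sum.mono_neutral_right)
    show "\<forall>\<sigma>\<in>Pow {..<length us} - (\<lambda>k. {k}) ` {..<length us}. c \<sigma> * taylor_basis_diff us \<sigma> {} = 0"
    proof (intro ballI, rule ccontr)
      fix \<sigma> assume \<sigma>: "\<sigma> \<in> Pow {..<length us} - (\<lambda>k. {k}) ` {..<length us}"
        and "c \<sigma> * taylor_basis_diff us \<sigma> {} \<noteq> 0"
      from mult_not_zero[OF this(2)] obtain j where "j \<in> \<sigma>" "\<sigma> = {j}"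
        using taylor_basis_diff_ne_0[of us \<sigma> "{}"] by blast
      then show False
        using \<sigma> by auto
    qed
  qed auto
  then show ?thesis
    by (simp add: sum.reindex inj_on_def taylor_basis_diff_singleton)
qed

text \<open>Multiplying the coefficient at an end of the edge by the generator there restores the
  lcm, so the two ends contribute the same monomial with opposite signs. This weighting turns the
  differential into the incidence relation of a graph.\<close>

lemma taylor_basis_diff_pair_mult:
  fixes us :: "'v::finite monom list"
  assumes "a < b"
  shows "(taylor_basis_diff us {a, b} {k} :: ('v, 'k::field) mpoly) * mono_poly (us ! k) =
    (if k = b then mono_poly (lcm_monom us {a, b}) else 0) - (if k = a then mono_poly (lcm_monom us {a, b}) else 0)"
proof -
  have "mono_poly (lcm_monom us {a, b} - us ! i) * mono_poly (us ! i) = (mono_poly (lcm_monom us {a, b}) :: ('v, 'k) mpoly)"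
    if "i \<in> {a, b}" for i
  proof -
    have "monom_dvd (us ! i) (lcm_monom us {a, b})"
      using lcm_monom_mono[of "{a, b}" "{i}" us] that by (simp add: lcm_monom_singleton)
    then show ?thesis
      using monom_dvd_add_diff by (metis add.commute mono_poly_add)
  qed
  then show ?thesis
    using assms by (simp add: taylor_basis_diff_pair)
qed

lemma sum_taylor_basis_diff_pair:
  assumes "a < b" "finite K"
  shows "(\<Sum>k\<in>K. taylor_basis_diff us {a, b} {k} * mono_poly (us ! k)) =
    (if b \<in> K then mono_poly (lcm_monom us {a, b}) else 0) - (if a \<in> K then mono_poly (lcm_monom us {a, b}) else 0)"
  using assms(2) by (simp add: taylor_basis_diff_pair_mult[OF assms(1)] sum_subtractf sum.delta)

lemma card_2_less:
  fixes \<sigma> :: "nat set"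
  assumes "card \<sigma> = 2"
  obtains a b where "a < b" "\<sigma> = {a, b}"
proof -
  obtain x y where "\<sigma> = {x, y}" "x \<noteq> y"
    using assms by (meson card_2_iff)
  then show ?thesis
    using that[of x y] that[of y x] by (cases "x < y") (auto simp: insert_commute)
qed

text \<open>If no edge of the Scarf complex crosses the cut \<open>K\<close>, the boundary of a 1-chain splits into two
  cycles, one supported on \<open>K\<close>.\<close>

lemma sum_taylor_diff_cut:
  assumes c: "c \<in> scarf_module us 2" and "finite K"
    and cut: "\<And>\<sigma> k l. \<sigma> \<in> scarf_faces us \<Longrightarrow> card \<sigma> = 2 \<Longrightarrow> k \<in> \<sigma> \<Longrightarrow> l \<in> \<sigma> \<Longrightarrow> k \<in> K \<longleftrightarrow> l \<in> K"
  shows "(\<Sum>k\<in>K. taylor_diff us c {k} * mono_poly (us ! k)) = 0"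
proof -
  have "(\<Sum>k\<in>K. taylor_diff us c {k} * mono_poly (us ! k))
      = (\<Sum>k\<in>K. \<Sum>\<sigma>\<in>Pow {..<length us}. c \<sigma> * (taylor_basis_diff us \<sigma> {k} * mono_poly (us ! k)))"
    by (simp only: taylor_diff_def sum_distrib_right mult.assoc)
  also have "\<dots> = (\<Sum>\<sigma>\<in>Pow {..<length us}. \<Sum>k\<in>K. c \<sigma> * (taylor_basis_diff us \<sigma> {k} * mono_poly (us ! k)))"
    by (rule sum.swap)
  also have "\<dots> = (\<Sum>\<sigma>\<in>Pow {..<length us}. c \<sigma> * (\<Sum>k\<in>K. taylor_basis_diff us \<sigma> {k} * mono_poly (us ! k)))"
    by (simp only: sum_distrib_left)
  \<comment> \<open>Both ends of a Scarf edge lie on the same side of \<open>K\<close>, so its two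
    contributions cancel or are both absent.\<close>
  also have "\<dots> = 0"
  proof (rule sum.neutral, rule ballI)
    fix \<sigma>
    show "c \<sigma> * (\<Sum>k\<in>K. taylor_basis_diff us \<sigma> {k} * mono_poly (us ! k)) = 0"
    proof (cases "c \<sigma> = 0")
      case False
      then have \<sigma>: "\<sigma> \<in> scarf_faces us" "card \<sigma> = 2"
        using c by (auto simp: scarf_module_def)
      obtain a b where ab: "a < b" "\<sigma> = {a, b}"
        using card_2_less[OF \<sigma>(2)] .
      then show ?thesis
        using cut[OF \<sigma>, of a b] by (simp add: sum_taylor_basis_diff_pair[OF ab(1) assms(2)])
    qed simp
  qed
  finally show ?thesis .
qed

text \<open>The component at the empty face is the weighted sum over the trivial cut, which consists
  of all indices. The other components vanish because the inner differential is supported on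
  singletons.\<close>

lemma taylor_diff_diff:
  assumes c: "c \<in> scarf_module us 2"
  shows "taylor_diff us (taylor_diff us c) = (\<lambda>_. 0)"
proof
  fix \<tau>
  show "taylor_diff us (taylor_diff us c) \<tau> = 0"
  proof (cases "\<tau> = {}")
    case True
    show ?thesis
      unfolding True taylor_diff_empty
    proof (rule sum_taylor_diff_cut[OF c])
      fix \<sigma> k l assume "\<sigma> \<in> scarf_faces us" "k \<in> \<sigma>" "l \<in> \<sigma>"
      then show "k \<in> {..<length us} \<longleftrightarrow> l \<in> {..<length us}"
        using scarf_faces_subset by blast
    qed simp
  next
    case False
    show ?thesis
    proof (rule ccontr)
      assume "taylor_diff us (taylor_diff us c) \<tau> \<noteq> 0"
      then obtain \<sigma> where "taylor_diff us c \<sigma> * taylor_basis_diff us \<sigma> \<tau> \<noteq> 0"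
        unfolding taylor_diff_def[of us "taylor_diff us c"] by (meson sum.neutral)
      note \<sigma> = mult_not_zero[OF this]
      have "Suc (card \<sigma>) = 2"
        by (rule taylor_diff_card(2)[OF c conjunct1[OF \<sigma>]])
      then obtain k where "\<sigma> = {k}"
        by (metis One_nat_def Suc_1 card_1_singletonE old.nat.inject)
      then show False
        using conjunct2[OF \<sigma>] False by (simp add: taylor_basis_diff_singleton)
    qed
  qed
qed

text \<open>Removing an element from a Scarf face changes the lcm, so every entry of the
  differential is, up to sign, a monomial other than 1 and divisible by some variable.\<close>

lemma taylor_diff_in_maximal_ideal:
  fixes c :: "nat set \<Rightarrow> ('v::finite, 'k::field) mpoly"
  assumes c: "c \<in> scarf_module us k"
  shows "taylor_diff us c \<tau> \<in> ideal_gen (range var)"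
  unfolding taylor_diff_def
proof (rule ideal.span_sum)
  fix \<sigma>
  show "c \<sigma> * taylor_basis_diff us \<sigma> \<tau> \<in> ideal_gen (range var)"
  proof (cases "c \<sigma> = 0")
    case True
    then show ?thesis
      by (simp add: ideal.span_zero)
  next
    case False
    then have \<sigma>: "\<sigma> \<in> scarf_faces us"
      using c by (auto simp: scarf_module_def)
    have entry: "mono_poly (lcm_monom us \<sigma> - lcm_monom us (\<sigma> - {j})) \<in> ideal_gen (range (var :: 'v \<Rightarrow> ('v, 'k) mpoly))"
      if "j \<in> \<sigma>" for j
    proof -
      have "monom_dvd (lcm_monom us (\<sigma> - {j})) (lcm_monom us \<sigma>)"
        using scarf_faces_finite[OF \<sigma>] by (intro lcm_monom_mono) auto
      from monom_dvd_add_diff[OF this]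
      obtain m where m: "m = lcm_monom us \<sigma> - lcm_monom us (\<sigma> - {j})" "lcm_monom us (\<sigma> - {j}) + m = lcm_monom us \<sigma>"
        by blast
      have "\<sigma> - {j} \<subseteq> {..<length us}" "\<sigma> - {j} \<noteq> \<sigma>"
        using \<sigma> that by (auto simp: scarf_faces_def)
      then have "lcm_monom us \<sigma> \<noteq> lcm_monom us (\<sigma> - {j})"
        using \<sigma> unfolding scarf_faces_def by blast
      then have "m \<noteq> 0"
        using m(2) by auto
      then obtain v where "Poly_Mapping.lookup m v \<noteq> 0"
        by (metis lookup_zero poly_mapping_eqI)
      then have "monom_dvd (Poly_Mapping.single v 1) m"
        by (auto simp: monom_dvd_iff lookup_single when_def)
      then have "(mono_poly m :: ('v, 'k) mpoly) \<in> ideal_gen (mono_poly ` range (\<lambda>v. Poly_Mapping.single v 1))"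
        unfolding mono_poly_in_ideal_gen_iff by blast
      also have "mono_poly ` range (\<lambda>v. Poly_Mapping.single v 1) = range (var :: 'v \<Rightarrow> ('v, 'k) mpoly)"
        by (auto simp: var_def)
      finally show ?thesis
        by (simp add: m(1))
    qed
    show ?thesis
      unfolding taylor_basis_diff_def
      by (intro ideal.span_scale ideal.span_sum) (auto intro!: ideal.span_scale entry ideal.span_zero)
  qed
qed

section \<open>Exactness of the Scarf complex\<close>

lemma cover_monom_inj: "inj cover_monom"
  by (simp add: inj_def squarefree_monom_eq_iff)

lemma ideal_gen_nth_sum:
  fixes p :: "('v::finite, 'k::field) mpoly"
  assumes "p \<in> ideal_gen (mono_poly ` set us)"
  shows "\<exists>a. p = (\<Sum>k<length us. a k * mono_poly (us ! k))"
  using assms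
proof (induction rule: ideal.span_induct_alt)
  case base
  show ?case
    by (rule exI[of _ "\<lambda>_. 0"]) simp
next
  case (step c x y)
  obtain a where a: "y = (\<Sum>k<length us. a k * mono_poly (us ! k))"
    using step.IH by blast
  obtain j where j: "j < length us" "x = mono_poly (us ! j)"
    using step.hyps by (auto simp: in_set_conv_nth)
  have "c * x + y = (\<Sum>k<length us. (if k = j then c * mono_poly (us ! j) else 0) + a k * mono_poly (us ! k))"
    using j by (simp add: sum.distrib a)
  also have "\<dots> = (\<Sum>k<length us. ((if k = j then c else 0) + a k) * mono_poly (us ! k))"
    by (rule sum.cong) (auto simp: distrib_right)
  finally show ?case
    by (rule exI[of _ "\<lambda>k. (if k = j then c else 0) + a k"])
qed

lemma monom_dvd_of_lookup_mult_mono_poly: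
  assumes "Poly_Mapping.lookup (p * mono_poly m) e \<noteq> 0"
  shows "monom_dvd m e"
proof -
  have "e \<in> Poly_Mapping.keys (p * mono_poly m)"
    using assms by (simp add: in_keys_iff)
  then obtain a where "e = a + m"
    using keys_mult[of p "mono_poly m"] by (auto simp: keys_mono_poly)
  then show ?thesis
    by (auto simp: monom_dvd_def add.commute)
qed

lemma scarf_module_1_eqI:
  assumes "c \<in> scarf_module us 1" "c' \<in> scarf_module us 1" "\<And>k. k < length us \<Longrightarrow> c {k} = c' {k}"
  shows "c = c'"
proof
  fix \<sigma>
  show "c \<sigma> = c' \<sigma>"
  proof (cases "\<sigma> \<in> scarf_faces us \<and> card \<sigma> = 1")
    case True
    then obtain k where "\<sigma> = {k}"
      by (meson card_1_singletonE)
    then show ?thesis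
      using assms(3)[of k] scarf_faces_subset[of \<sigma> us] True by auto
  next
    case False
    then show ?thesis
      using assms(1,2) by (metis (mono_tags, lifting) mem_Collect_eq scarf_module_def)
  qed
qed

lemma scarf_faces_cover_monom_small:
  assumes "distinct Gs" "antichain (set Gs)" "UNIV \<notin> set Gs"
  shows "{} \<in> scarf_faces (map cover_monom Gs)"
    and "k < length Gs \<Longrightarrow> {k} \<in> scarf_faces (map cover_monom Gs)"
  using assms by (simp_all add: scarf_faces_cover_monom scarf_family_empty scarf_family_singleton)

section \<open>Exactness when all tree edges are Scarf faces\<close>

locale scarf_tree = branch_tree Fs parent for Fs :: "'v::finite set list" and parent +
  assumes scarf_edge: "0 < i \<Longrightarrow> i < length Fs \<Longrightarrow> scarf_family (set Fs) {Fs ! parent i, Fs ! i}"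
begin

text \<open>With the generators listed in the leaf order, index \<open>i\<close> of the Taylor
  complex is vertex \<open>i\<close> of the tree, and the parent is always the smaller end of an
  edge.\<close>

abbreviation us :: "'v monom list" where
  "us \<equiv> map cover_monom Fs"

lemma scarf_faces_small: "{} \<in> scarf_faces us" "k < length Fs \<Longrightarrow> {k} \<in> scarf_faces us"
  using scarf_faces_cover_monom_small[OF distinct anti proper] by auto

lemma scarf_faces_edge: "0 < i \<Longrightarrow> i < length Fs \<Longrightarrow> {parent i, i} \<in> scarf_faces us"
  using scarf_edge parent_length by (simp add: scarf_faces_cover_monom[OF distinct])

lemma card_edge: "0 < i \<Longrightarrow> i < length Fs \<Longrightarrow> card {parent i, i} = 2"
  using parent_less[of i] by (simp add: card_2_iff)

lemma scarf_faces_cases: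
  assumes "\<sigma> \<in> scarf_faces us"
  obtains "\<sigma> = {}" | k where "k < length Fs" "\<sigma> = {k}"
  | i where "0 < i" "i < length Fs" "\<sigma> = {parent i, i}"
proof -
  have inj: "inj_on ((!) Fs) {..<length Fs}"
    using distinct by (simp add: inj_on_nth)
  have \<sigma>: "\<sigma> \<subseteq> {..<length Fs}" "scarf_family (set Fs) ((!) Fs ` \<sigma>)"
    using assms by (auto simp: scarf_faces_cover_monom[OF distinct])
  from \<sigma>(2) show ?thesis
  proof (cases rule: scarf_family_cases)
    case 1
    then show ?thesis
      using that(1) by simp
  next
    case (2 F)
    then obtain k where k: "k < length Fs" "F = Fs ! k"
      by (auto simp: in_set_conv_nth)
    have "(!) Fs ` \<sigma> = (!) Fs ` {k}"
      using 2 k by simp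
    then have "\<sigma> = {k}"
      using inj_on_image_eq_iff[OF inj \<sigma>(1), of "{k}"] k(1) by simp
    then show ?thesis
      using that(2) k(1) by blast
  next
    case (3 i)
    have "(!) Fs ` \<sigma> = (!) Fs ` {parent i, i}"
      using 3 by simp
    then have "\<sigma> = {parent i, i}"
      using inj_on_image_eq_iff[OF inj \<sigma>(1), of "{parent i, i}"] 3(1,2) parent_length by simp
    then show ?thesis
      using that(3) 3(1,2) by blast
  qed
qed

lemma scarf_faces_card_2:
  assumes "\<sigma> \<in> scarf_faces us" "card \<sigma> = 2"
  obtains i where "0 < i" "i < length Fs" "\<sigma> = {parent i, i}"
  using assms(1) by (cases rule: scarf_faces_cases) (use assms(2) that in auto)

lemma scarf_module_ge_3:
  assumes "k \<ge> 3"
  shows "scarf_module us k = {\<lambda>_. 0}"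
proof -
  have "card \<sigma> \<noteq> k" if "\<sigma> \<in> scarf_faces us" for \<sigma>
    using that by (cases rule: scarf_faces_cases) (use assms card_edge in auto)
  then have "c = (\<lambda>_. 0)" if "c \<in> scarf_module us k" for c
    using that unfolding scarf_module_def by blast
  then show ?thesis
    using scarf_module_zero by blast
qed

text \<open>Let \<open>i\<close> be the largest lower end, that is, child, of an edge in the support
  of \<open>c\<close>. Every other edge of the support has both ends below \<open>i\<close>, so the
  coefficient of the boundary at \<open>{i}\<close> is \<open>c {parent i, i}\<close> times a
  monomial, and monomials are not zero divisors.\<close>

lemma taylor_diff_inj:
  fixes c :: "nat set \<Rightarrow> ('v, 'k::field) mpoly"
  assumes c: "c \<in> scarf_module us 2" and d: "taylor_diff us c = (\<lambda>_. 0)"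
  shows "c = (\<lambda>_. 0)"
proof (rule ccontr)
  assume "c \<noteq> (\<lambda>_. 0)"
  then obtain \<sigma> where "c \<sigma> \<noteq> 0"
    by blast
  define I where "I = {i. 0 < i \<and> i < length Fs \<and> c {parent i, i} \<noteq> 0}"
  have supp: "\<exists>i\<in>I. \<sigma> = {parent i, i}" if "c \<sigma> \<noteq> 0" for \<sigma>
  proof -
    have "\<sigma> \<in> scarf_faces us" "card \<sigma> = 2"
      using c that by (auto simp: scarf_module_def)
    then obtain i where "0 < i" "i < length Fs" "\<sigma> = {parent i, i}"
      by (rule scarf_faces_card_2)
    then show ?thesis
      using that by (auto simp: I_def)
  qed
  have fin: "finite I"
    by (rule finite_subset[of _ "{..<length Fs}"]) (auto simp: I_def)
  have "I \<noteq> {}"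
    using supp \<open>c \<sigma> \<noteq> 0\<close> by blast
  define i where "i = Max I"
  have "i \<in> I"
    unfolding i_def using fin \<open>I \<noteq> {}\<close> by (rule Max_in)
  then have i: "0 < i" "i < length Fs" "c {parent i, i} \<noteq> 0"
    by (auto simp: I_def)
  have "taylor_diff us c {i} = (\<Sum>\<sigma>\<in>{{parent i, i}}. c \<sigma> * taylor_basis_diff us \<sigma> {i})"
    unfolding taylor_diff_def
  proof (rule sum.mono_neutral_right)
    show "{{parent i, i}} \<subseteq> Pow {..<length us}"
      using i(2) parent_length[OF i(1,2)] by simp
    show "\<forall>\<sigma>\<in>Pow {..<length us} - {{parent i, i}}. c \<sigma> * taylor_basis_diff us \<sigma> {i} = 0"
    proof (intro ballI, rule ccontr)
      fix \<sigma> assume "\<sigma> \<in> Pow {..<length us} - {{parent i, i}}" and "c \<sigma> * taylor_basis_diff us \<sigma> {i} \<noteq> 0"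
      note ne = mult_not_zero[OF this(2)] and \<sigma> = this(1)
      obtain k where k: "k \<in> I" "\<sigma> = {parent k, k}"
        using supp ne by blast
      then have "k \<le> i" "0 < k" "k < length Fs"
        using fin by (auto simp: i_def I_def)
      moreover have "k \<noteq> i"
        using \<sigma> k(2) by auto
      moreover have "i \<in> \<sigma>"
        using taylor_basis_diff_ne_0 conjunct2[OF ne] by blast
      ultimately show False
        using k(2) parent_less[of k] by auto
    qed
  qed simp
  also have "\<dots> = c {parent i, i} * mono_poly (lcm_monom us {parent i, i} - us ! i)"
    by (simp add: taylor_basis_diff_pair[OF parent_less[OF i(1,2)]])
  finally have "mono_poly (lcm_monom us {parent i, i} - us ! i) * c {parent i, i} = 0"
    using d by (simp add: mult.commute)
  then show False
    using mono_poly_mult_eq_0 i(3) by blast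
qed

text \<open>The last coefficient of a syzygy of the monomials \<open>us ! 0, \<dots>, us ! t\<close> lies in the ideal of
  quotients \<open>us ! j / gcd (us ! j) (us ! t)\<close>, which the branch property makes principal.\<close>

lemma syzygy_last_coefficient:
  fixes c :: "nat \<Rightarrow> ('v, 'k::field) mpoly"
  assumes t: "0 < t" "t < length Fs"
    and syz: "(\<Sum>k\<le>t. c k * mono_poly (us ! k)) = 0"
  obtains r where "c t = mono_poly (lcm_monom us {parent t, t} - us ! t) * r"
proof (rule mono_poly_dvd)
  fix k assume k: "k \<in> Poly_Mapping.keys (c t)"
  \<comment> \<open>The exponent \<open>e\<close> of a term of
    \<open>c t * mono_poly (us ! t)\<close>. The syzygy forces the same exponent to occur in some
    \<open>c j * mono_poly (us ! j)\<close> with \<open>j < t\<close>, so \<open>us ! j\<close>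
    divides it.\<close>
  define e where "e = us ! t + k"
  have "(\<Sum>j\<le>t. Poly_Mapping.lookup (c j * mono_poly (us ! j)) e) = 0"
    unfolding lookup_sum[symmetric] syz by simp
  moreover have "Poly_Mapping.lookup (c t * mono_poly (us ! t)) e \<noteq> 0"
    using k by (simp add: e_def mult.commute[of "c t"] lookup_mono_poly_mult in_keys_iff)
  ultimately have "(\<Sum>j<t. Poly_Mapping.lookup (c j * mono_poly (us ! j)) e) \<noteq> 0"
    by (auto simp: lessThan_Suc_atMost[symmetric])
  then obtain j where j: "j < t" "Poly_Mapping.lookup (c j * mono_poly (us ! j)) e \<noteq> 0"
    by (metis (no_types, lifting) lessThan_iff sum.neutral)
  have dvd: "monom_dvd (us ! j) e"
    using j(2) by (rule monom_dvd_of_lookup_mult_mono_poly)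
  have L: "lcm_monom us {parent t, t} = cover_monom (Fs ! parent t \<inter> Fs ! t)"
    using lcm_cover_monom[of "{parent t, t}" Fs] t parent_length[OF t] by simp
  have sub: "Fs ! j \<inter> Fs ! t \<subseteq> Fs ! parent t"
    using branch j(1) t(2) by blast
  show "monom_dvd (lcm_monom us {parent t, t} - us ! t) k"
    unfolding monom_dvd_iff
  proof
    fix v
    have "Poly_Mapping.lookup (us ! j) v \<le> Poly_Mapping.lookup (us ! t) v + Poly_Mapping.lookup k v"
      using dvd by (simp add: monom_dvd_iff e_def lookup_add)
    \<comment> \<open>The quotient has exponent 1 at \<open>v\<close> exactly when \<open>v\<close>
      lies in \<open>Fs ! t\<close> but not in its branch. Then \<open>v\<close> is not in
      \<open>Fs ! j\<close> by the branch property, so \<open>us ! j\<close> has exponent 1 at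
      \<open>v\<close> while \<open>us ! t\<close> has 0, and \<open>k\<close> must supply the
      difference.\<close>
    then show "Poly_Mapping.lookup (lcm_monom us {parent t, t} - us ! t) v \<le> Poly_Mapping.lookup k v"
      using sub j(1) t(2) by (auto simp: lookup_minus L lookup_squarefree_monom split: if_splits)
  qed
qed (rule that)

lemma taylor_diff_scarf_module_1:
  assumes "b \<in> scarf_module us 2"
  shows "taylor_diff us b \<in> scarf_module us 1"
proof -
  have "\<tau> \<in> scarf_faces us \<and> card \<tau> = 1" if "taylor_diff us b \<tau> \<noteq> 0" for \<tau>
  proof -
    have \<tau>: "\<tau> \<subseteq> {..<length Fs}" "card \<tau> = 1"
      using taylor_diff_card[OF assms that] by auto
    then obtain k where "\<tau> = {k}"
      by (meson card_1_singletonE)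
    then show ?thesis
      using \<tau> scarf_faces_small(2) by simp
  qed
  then show ?thesis
    by (simp add: scarf_module_def)
qed

text \<open>Induction on a bound \<open>t\<close> for the positions where \<open>c\<close> is
  nonzero. Subtracting a multiple of the boundary of the edge at the last position clears that
  position and otherwise changes only its parent, which is smaller. A syzygy supported on the single
  position 0 is zero.\<close>

lemma taylor_diff_exact_1:
  fixes c :: "nat set \<Rightarrow> ('v, 'k::field) mpoly"
  assumes "c \<in> scarf_module us 1" "taylor_diff us c = (\<lambda>_. 0)"
  shows "\<exists>b\<in>scarf_module us 2. taylor_diff us b = c"
proof -
  have "\<exists>b\<in>scarf_module us 2. taylor_diff us b = c"
    if "t \<le> length Fs" "\<forall>k\<ge>t. c {k} = 0" "c \<in> scarf_module us 1" "taylor_diff us c = (\<lambda>_. 0)"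
    for t and c :: "nat set \<Rightarrow> ('v, 'k) mpoly"
    using that
  proof (induction t arbitrary: c)
    case 0
    then have "c = (\<lambda>_. 0)"
      by (intro scarf_module_1_eqI[OF _ scarf_module_zero]) auto
    then show ?case
      using scarf_module_zero taylor_diff_zero by metis
  next
    case (Suc t)
    have tl: "t < length Fs"
      using Suc.prems(1) by simp
    have "0 = (\<Sum>k<length Fs. c {k} * mono_poly (us ! k))"
      using fun_cong[OF Suc.prems(4), of "{}"] taylor_diff_empty[of us c] by simp
    also have "\<dots> = (\<Sum>k\<le>t. c {k} * mono_poly (us ! k))"
      by (rule sum.mono_neutral_right) (use tl Suc.prems(2) in \<open>auto simp: not_le\<close>)
    finally have syz: "(\<Sum>k\<le>t. c {k} * mono_poly (us ! k)) = 0"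
      by simp
    show ?case
    proof (cases "t = 0")
      case True
      then have "mono_poly (us ! 0) * c {0} = 0"
        using syz by (simp add: mult.commute)
      then have "c {0} = 0"
        by (rule mono_poly_mult_eq_0)
      then have "\<forall>k\<ge>t. c {k} = 0"
        using Suc.prems(2) True by (metis Suc_leI le_eq_less_or_eq)
      then show ?thesis
        using Suc by simp
    next
      case False
      then have t: "0 < t" "t < length Fs"
        using tl by auto
      let ?\<sigma> = "{parent t, t}"
      obtain r where r: "c {t} = mono_poly (lcm_monom us ?\<sigma> - us ! t) * r"
        using syzygy_last_coefficient[OF t, of "\<lambda>k. c {k}"] syz by blast
      define b :: "('v, 'k) mpoly \<Rightarrow> nat set \<Rightarrow> ('v, 'k) mpoly" where
        "b s = (\<lambda>\<rho>. if \<rho> = ?\<sigma> then s else 0)" for s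
      have b2: "b s \<in> scarf_module us 2" for s
        using scarf_faces_edge[OF t] card_edge[OF t] by (simp add: scarf_module_def b_def)
      have db: "taylor_diff us (b s) = (\<lambda>\<tau>. s * taylor_basis_diff us ?\<sigma> \<tau>)" for s
        unfolding b_def using t parent_length[OF t] by (intro taylor_diff_single) simp
      note db1 = taylor_diff_scarf_module_1[OF b2]
      \<comment> \<open>As \<open>t\<close> is the larger end, the boundary of its edge has a
        positive sign at \<open>{t}\<close>; the factor \<open>- r\<close> therefore cancels
        \<open>c {t}\<close> exactly.\<close>
      define c' where "c' = (\<lambda>\<tau>. c \<tau> + taylor_diff us (b (- r)) \<tau>)"
      have "c' \<in> scarf_module us 1"
        using Suc.prems(3) db1[of "- r"] unfolding c'_def scarf_module_def by (auto; force)
      moreover have "taylor_diff us c' = (\<lambda>_. 0)"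
        unfolding c'_def taylor_diff_add using Suc.prems(4) taylor_diff_diff[OF b2] by simp
      moreover have "c' {k} = 0" if "t \<le> k" for k
        using that Suc.prems(2) r parent_less[OF t]
        by (cases "k = t") (simp_all add: c'_def db mult.commute taylor_basis_diff_pair[OF parent_less[OF t]])
      ultimately obtain b' where b': "b' \<in> scarf_module us 2" "taylor_diff us b' = c'"
        using Suc.IH[of c'] tl by auto
      have "taylor_diff us (\<lambda>\<rho>. b' \<rho> + b r \<rho>) = c"
        unfolding taylor_diff_add b'(2) by (simp add: c'_def db)
      moreover have "(\<lambda>\<rho>. b' \<rho> + b r \<rho>) \<in> scarf_module us 2"
        using b'(1) b2[of r] unfolding scarf_module_def by (auto; force)
      ultimately show ?thesis
        by blast
    qed
  qed
  from this[of "length Fs" c] show ?thesis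
    using assms scarf_faces_subset by (fastforce simp: scarf_module_def)
qed

lemma scarf_complex_exact:
  assumes "k \<ge> 1"
  shows "{c \<in> scarf_module us k. taylor_diff us c = (\<lambda>_. 0)}
    = (taylor_diff us ` scarf_module us (Suc k) :: (nat set \<Rightarrow> ('v, 'k::field) mpoly) set)"
  (is "?Z = ?B")
proof -
  consider "k = 1" | "k = 2" | "k \<ge> 3"
    using assms by linarith
  then show ?thesis
  proof cases
    case 1
    have "taylor_diff us b \<in> ?Z" if "b \<in> scarf_module us 2" for b :: "nat set \<Rightarrow> ('v, 'k) mpoly"
      using taylor_diff_scarf_module_1[OF that] taylor_diff_diff[OF that] 1 by simp
    then have "?B \<subseteq> ?Z"
      using 1 by (auto simp: numeral_2_eq_2)
    moreover have "?Z \<subseteq> ?B"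
      using taylor_diff_exact_1 1 by (fastforce simp: numeral_2_eq_2)
    ultimately show ?thesis
      by (rule equalityI[rotated])
  next
    case 2
    have "?Z = {\<lambda>_. 0}"
      using taylor_diff_inj scarf_module_zero taylor_diff_zero 2 by blast
    then show ?thesis
      using 2 by (simp add: scarf_module_ge_3 taylor_diff_zero)
  next
    case 3
    then show ?thesis
      by (auto simp: scarf_module_ge_3 taylor_diff_zero)
  qed
qed

lemma scarf_complex_exact_0:
  fixes J :: "('v, 'k::field) mpoly set"
  assumes J: "J = ideal_gen (mono_poly ` set us)"
  shows "{c \<in> scarf_module us 0. c {} \<in> J} = taylor_diff us ` scarf_module us 1"
proof (intro equalityI subsetI)
  fix c assume "c \<in> taylor_diff us ` (scarf_module us 1 :: (nat set \<Rightarrow> ('v, 'k) mpoly) set)"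
  then obtain b :: "nat set \<Rightarrow> ('v, 'k) mpoly" where b: "b \<in> scarf_module us 1" "c = taylor_diff us b"
    by blast
  have "\<tau> \<in> scarf_faces us \<and> card \<tau> = 0" if "c \<tau> \<noteq> 0" for \<tau>
  proof -
    have "\<tau> \<subseteq> {..<length us}" "card \<tau> = 0"
      using taylor_diff_card[OF b(1)] that b(2) by auto
    then have "\<tau> = {}"
      using finite_subset by fastforce
    then show ?thesis
      using scarf_faces_small(1) by simp
  qed
  then have "c \<in> scarf_module us 0"
    by (simp add: scarf_module_def)
  moreover have "c {} \<in> J"
    unfolding b(2) taylor_diff_empty J by (intro ideal.span_sum ideal.span_scale ideal.span_base) auto
  ultimately show "c \<in> {c \<in> scarf_module us 0. c {} \<in> J}"
    by simp
next
  fix c :: "nat set \<Rightarrow> ('v, 'k) mpoly"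
  assume "c \<in> {c \<in> scarf_module us 0. c {} \<in> J}"
  then have c: "c \<in> scarf_module us 0" "c {} \<in> ideal_gen (mono_poly ` set us)"
    by (auto simp: J)
  obtain a where a: "c {} = (\<Sum>k<length us. a k * mono_poly (us ! k))"
    using ideal_gen_nth_sum[OF c(2)] by blast
  define b where "b = (\<lambda>\<sigma>. if \<exists>k<length us. \<sigma> = {k} then a (the_elem \<sigma>) else 0)"
  have b: "b \<in> scarf_module us 1"
    using scarf_faces_small(2) by (auto simp: b_def scarf_module_def)
  have "taylor_diff us b = c"
  proof
    fix \<tau>
    show "taylor_diff us b \<tau> = c \<tau>"
    proof (cases "\<tau> = {}")
      case True
      have "b {k} = a k" if "k < length us" for k
        using that by (auto simp: b_def)
      then show ?thesis
        unfolding True taylor_diff_empty a by simp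
    next
      case False
      have "c \<tau> = 0"
      proof (rule ccontr)
        assume "c \<tau> \<noteq> 0"
        then have "\<tau> \<in> scarf_faces us" "card \<tau> = 0"
          using c(1) by (auto simp: scarf_module_def)
        then show False
          using False scarf_faces_finite[of \<tau> us] by simp
      qed
      moreover have "taylor_diff us b \<tau> = 0"
      proof (rule ccontr)
        assume "taylor_diff us b \<tau> \<noteq> 0"
        then have "\<tau> \<subseteq> {..<length us}" "card \<tau> = 0"
          using taylor_diff_card[OF b] by auto
        then show False
          using False finite_subset by fastforce
      qed
      ultimately show ?thesis
        by simp
    qed
  qed
  then show "c \<in> taylor_diff us ` scarf_module us 1"
    using b by blast
qed

lemma scarf_complex_is_minimal_resolution:
  "scarf_complex_is_minimal_resolution us (ideal_gen (mono_poly ` set us) :: ('v, 'k::field) mpoly set)"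
proof -
  have "\<exists>c\<in>scarf_module us 0. s - c {} \<in> ideal_gen (mono_poly ` set us)" for s :: "('v, 'k) mpoly"
    using scarf_faces_small(1)
    by (intro bexI[of _ "\<lambda>\<sigma>. if \<sigma> = {} then s else 0"]) (auto simp: scarf_module_def ideal.span_zero)
  then show ?thesis
    unfolding scarf_complex_is_minimal_resolution_def
    by (intro conjI allI impI scarf_complex_exact scarf_complex_exact_0[OF refl] taylor_diff_in_maximal_ideal)
qed

end

text \<open>If the tree edge at \<open>i\<close> were missing from the Scarf complex, then cutting the tree there would
  separate the Scarf complex, although the two ends of the edge are joined by a syzygy.\<close>

lemma scarf_resolution_imp_scarf_family:
  fixes J :: "('v::finite, 'k::field) mpoly set" and Gs :: "'v set list"
  assumes tree: "branch_tree Fs parent"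
    and Gs: "distinct Gs" "set Gs = set Fs"
    and res: "scarf_complex_is_minimal_resolution (map cover_monom Gs) J"
    and i: "0 < i" "i < length Fs"
  shows "scarf_family (set Fs) {Fs ! parent i, Fs ! i}"
proof (rule ccontr)
  assume not_scarf: "\<not> scarf_family (set Fs) {Fs ! parent i, Fs ! i}"
  interpret branch_tree Fs parent
    by (rule tree)
  let ?us = "map cover_monom Gs"
  \<comment> \<open>The cut is a set of facets because \<open>Gs\<close> may list them in another
    order than \<open>Fs\<close>; \<open>K\<close> below is the same cut in positions of
    \<open>Gs\<close>.\<close>
  define D where "D = (!) Fs ` (descendants i \<inter> {..<length Fs})"
  have D: "Fs ! k \<in> D \<longleftrightarrow> k \<in> descendants i" if "k < length Fs" for k
    using that nth_eq by (auto simp: D_def)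
  define K where "K = {k. k < length Gs \<and> Gs ! k \<in> D}"
  have fin: "finite K"
    by (simp add: K_def)
  have "Fs ! parent i \<in> set Gs" "Fs ! i \<in> set Gs"
    using Gs(2) i parent_length[OF i] by auto
  then obtain p q where pq: "p < length Gs" "Gs ! p = Fs ! parent i" "q < length Gs" "Gs ! q = Fs ! i"
    by (metis in_set_conv_nth)
  have K: "p \<notin> K" "q \<in> K"
    using pq D[OF parent_length[OF i]] D[OF i(2)] parent_notin_descendants[OF i] descendants.self
    by (auto simp: K_def)
  then have "p \<noteq> q"
    by blast
  \<comment> \<open>The Taylor signs follow the positions in \<open>Gs\<close>, where either end of
    the tree edge may come first.\<close>
  then obtain a b where ab: "a < b" "{a, b} = {p, q}"
    using card_2_less[of "{p, q}"] by (metis card_2_iff)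
  have ab_len: "a < length Gs" "b < length Gs"
    using ab(2) pq(1,3) by (auto simp: doubleton_eq_iff)
  let ?L = "mono_poly (lcm_monom ?us {a, b}) :: ('v, 'k) mpoly"
  \<comment> \<open>The Taylor boundary of the missing edge. It is a 1-cycle of the Scarf complex,
    since its vertices are Scarf faces even though the edge is not.\<close>
  let ?c = "taylor_basis_diff ?us {a, b} :: nat set \<Rightarrow> ('v, 'k) mpoly"
  have c1: "?c \<in> scarf_module ?us 1"
    using scarf_faces_cover_monom_small(2)[of Gs] Gs anti proper ab_len
    by (auto simp: scarf_module_def taylor_basis_diff_pair[OF ab(1)] split: if_splits)
  have "taylor_diff ?us ?c \<tau> = 0" for \<tau>
  proof (cases "\<tau> = {}")
    case True
    show ?thesis
      unfolding True taylor_diff_empty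
      using sum_taylor_basis_diff_pair[OF ab(1), of "{..<length Gs}" ?us] ab_len by simp
  next
    case False
    show ?thesis
    proof (rule ccontr)
      assume "taylor_diff ?us ?c \<tau> \<noteq> 0"
      then have "\<tau> \<subseteq> {..<length ?us}" "card \<tau> = 0"
        using taylor_diff_card[OF c1] by auto
      then show False
        using False finite_subset by fastforce
    qed
  qed
  then have "?c \<in> {c. c \<in> scarf_module ?us 1 \<and> taylor_diff ?us c = (\<lambda>_. 0)}"
    using c1 by blast
  also have "\<dots> = taylor_diff ?us ` scarf_module ?us (Suc 1)"
    using res unfolding scarf_complex_is_minimal_resolution_def by blast
  finally obtain e :: "nat set \<Rightarrow> ('v, 'k) mpoly" where e: "e \<in> scarf_module ?us 2" "?c = taylor_diff ?us e"
    by (auto simp: numeral_2_eq_2)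
  have "(\<Sum>k\<in>K. taylor_diff ?us e {k} * mono_poly (?us ! k)) = 0"
  proof (rule sum_taylor_diff_cut[OF e(1) fin])
    fix \<sigma> k l assume \<sigma>: "\<sigma> \<in> scarf_faces ?us" "card \<sigma> = 2" and kl: "k \<in> \<sigma>" "l \<in> \<sigma>"
    have sub: "\<sigma> \<subseteq> {..<length Gs}" and fam: "scarf_family (set Fs) ((!) Gs ` \<sigma>)"
      using \<sigma>(1) by (auto simp: scarf_faces_cover_monom[OF Gs(1)] Gs(2))
    have "card ((!) Gs ` \<sigma>) = 2"
      using \<sigma>(2) card_image[of "(!) Gs" \<sigma>] inj_on_nth[OF Gs(1), of \<sigma>] sub by auto
    with fam obtain j where j: "0 < j" "j < length Fs" "(!) Gs ` \<sigma> = {Fs ! parent j, Fs ! j}"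
      by (cases rule: scarf_family_cases) auto
    \<comment> \<open>The Scarf edge comes from a tree edge different from the missing one, so it
      does not cross the cut.\<close>
    then have "j \<noteq> i"
      using fam not_scarf by auto
    then have "Fs ! parent j \<in> D \<longleftrightarrow> Fs ! j \<in> D"
      using D descendants_parent_iff j(1,2) parent_length by simp
    moreover have "Gs ! k \<in> {Fs ! parent j, Fs ! j}" "Gs ! l \<in> {Fs ! parent j, Fs ! j}"
      using kl j(3) by blast+
    ultimately show "k \<in> K \<longleftrightarrow> l \<in> K"
      using kl sub by (auto simp: K_def)
  qed
  \<comment> \<open>Exactly one of \<open>a\<close> and \<open>b\<close> lies in \<open>K\<close>,
    so the weighted sum over \<open>K\<close> is the nonzero monomial \<open>?L\<close> up to
    sign.\<close>
  then have "(if b \<in> K then ?L else 0) - (if a \<in> K then ?L else 0) = 0"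
    unfolding e(2)[symmetric] sum_taylor_basis_diff_pair[OF ab(1) fin] .
  moreover have "(a \<in> K) \<noteq> (b \<in> K)"
    using ab(2) K by (auto simp: doubleton_eq_iff)
  ultimately show False
    using mono_poly_ne_0[of "lcm_monom ?us {a, b}", where ?'b = 'k] by (auto split: if_splits)
qed

theorem theorem2p3:
  fixes G :: "'v::finite set set"
  assumes "simple_graph G"
    and "no_isolated_vertices G"
    and "chordal (complementary_graph G)"
  shows
    "(has_scarf_resolution (vertex_cover_ideal G :: ('v, 'k::field) mpoly set) \<longleftrightarrow>
       (\<exists>Fs. leaf_order (clique_complex (complementary_graph G)) Fs \<and> sensitive Fs)) \<and>
     ((\<exists>Fs. leaf_order (clique_complex (complementary_graph G)) Fs \<and> sensitive Fs) \<longleftrightarrow>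
       (\<forall>Fs. leaf_order (clique_complex (complementary_graph G)) Fs \<longrightarrow> sensitive Fs))"
proof -
  let ?\<Delta> = "clique_complex (complementary_graph G)"
  let ?J = "vertex_cover_ideal G :: ('v, 'k) mpoly set"
  have J: "?J = ideal_gen (mono_poly ` cover_monom ` facets ?\<Delta>)"
    by (rule vertex_cover_ideal_eq[OF assms(1)])
  have gens: "min_gens ?J = cover_monom ` facets ?\<Delta>"
    unfolding J by (rule min_gens_cover_monom[OF antichain_facets])
  have "simple_graph (complementary_graph G)"
    by (auto simp: simple_graph_def complementary_graph_def)
  then obtain Fs0 where "leaf_order ?\<Delta> Fs0"
    using chordal_leaf_order_exists assms(3) by blast
  have "UNIV \<notin> ?\<Delta>"
  proof
    assume "UNIV \<in> ?\<Delta>"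
    obtain e where "e \<in> G"
      using assms(2) unfolding no_isolated_vertices_def by blast
    then obtain i j where "{i, j} \<in> G" "i \<noteq> j"
      using assms(1) unfolding simple_graph_def by (metis card_2_iff)
    then show False
      using clique_complexD[OF \<open>UNIV \<in> ?\<Delta>\<close>, of i j] by (simp add: complementary_graph_iff)
  qed
  then have proper: "UNIV \<notin> facets ?\<Delta>"
    by (simp add: facets_def)
  have sensitive_imp: "has_scarf_resolution ?J" if Fs: "leaf_order ?\<Delta> Fs" and "sensitive Fs" for Fs
  proof -
    obtain parent where "branch_tree Fs parent"
      using leaf_order_branch_tree[OF Fs proper] .
    then interpret branch_tree Fs parent .
    interpret scarf_tree Fs parent
      by unfold_locales (rule sensitive_imp_scarf_family[OF \<open>sensitive Fs\<close>])
    have set: "set us = cover_monom ` facets ?\<Delta>"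
      using Fs by (simp add: leaf_order_iff)
    have "distinct us"
      using distinct by (simp add: distinct_map inj_on_subset[OF cover_monom_inj])
    then show ?thesis
      unfolding has_scarf_resolution_def
      using scarf_complex_is_minimal_resolution[where ?'k = 'k] gens set J by metis
  qed
  have imp_sensitive: "sensitive Fs" if res: "has_scarf_resolution ?J" and Fs: "leaf_order ?\<Delta> Fs" for Fs
  proof -
    obtain parent where tree: "branch_tree Fs parent"
      using leaf_order_branch_tree[OF Fs proper] .
    obtain ms where ms: "distinct ms" "set ms = cover_monom ` facets ?\<Delta>"
      "scarf_complex_is_minimal_resolution ms ?J"
      using res unfolding has_scarf_resolution_def gens by blast
    \<comment> \<open>The resolution comes with an arbitrary labelling of the generators, which is
      pulled back to a list of facets.\<close>
    then have "\<forall>m\<in>set ms. \<exists>F. m = cover_monom F"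
      by auto
    then obtain Gs where Gs: "ms = map cover_monom Gs"
      unfolding ex_map_conv[symmetric] by blast
    have "distinct Gs"
      using ms(1) Gs by (simp add: distinct_map)
    moreover have "set Gs = set Fs"
      using ms(2) Gs Fs inj_image_eq_iff[OF cover_monom_inj, of "set Gs" "set Fs"] by (simp add: leaf_order_iff)
    ultimately have "scarf_family (set Fs) {Fs ! parent i, Fs ! i}" if "0 < i" "i < length Fs" for i
      using scarf_resolution_imp_scarf_family[OF tree] ms(3) Gs that by blast
    then show ?thesis
      by (rule branch_tree.scarf_family_imp_sensitive[OF tree])
  qed
  show ?thesis
    using sensitive_imp imp_sensitive \<open>leaf_order ?\<Delta> Fs0\<close> by blast
qed

end
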